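(* Let $1 < p \in \mathbb{R}$, let $\Gamma$ be a connected graph of bounded degree, with no self-loops and with countably infinite vertex set $V$, and let $n \in \mathbb{N}$. Then there exist $n$ pairwise disjoint $D_p$-massive subsets $D_1, D_2, \dots, D_n$ of $V$ if and only if $|\partial_p(\Gamma)| \geq n$, where $|\partial_p(\Gamma)|$ is the cardinality of the $p$-harmonic boundary $\partial_p(\Gamma)$ of $\Gamma$.
   Context: Let $N_x$ denote the set of neighbors of a vertex $x$. $\Gamma$ has bounded degree if there is a positive integer $k$ with $|N_x| \le k$ for all $x \in V$. For $S \subseteq V$, the outer boundary $\partial S$ is the set of vertices in $V \setminus S$ with at least one neighbor in $S$. A subset of $V$ is connected if the subgraph it induces is connected. Functions on $V$ are real-valued. For $f\colon V \to \mathbb{R}$ put $I_p(f,V) = \sum_{x \in V}\sum_{y \in N_x} |f(y)-f(x)|^p$ and $\Delta_p f(x) = \sum_{y \in N_x} |f(y)-f(x)|^{p-2}(f(y)-f(x))$, where a summand is taken to be $0$ if $f(y)=f(x)$. $D_p(\Gamma)$ is the set of $f\colon V\to\mathbb{R}$ with $I_p(f,V)<\infty$, with norm $\|f\|_{D_p} = (I_p(f,V)+|f(o)|^p)^{1/p}$ for a fixed vertex $o$. $BD_p(\Gamma)$ is the set of bounded functions in $D_p(\Gamma)$; with the norm $\|f\|_{BD_p} = I_p(f,V)^{1/p} + \sup_V|f|$ and pointwise operations it is a commutative real Banach algebra. $C_c(\Gamma)$ is the set of finitely supported functions on $V$, $\overline{C_c(\Gamma)}_{D_p}$ is its closure in $D_p(\Gamma)$,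 and $B(\overline{C_c(\Gamma)}_{D_p})$ is the set of bounded functions in $\overline{C_c(\Gamma)}_{D_p}$. $Sp(BD_p(\Gamma))$ is the set of characters, i.e. nonzero $\mathbb{R}$-algebra homomorphisms $BD_p(\Gamma) \to \mathbb{C}$ (they are in fact real-valued), with the weak-$*$ topology (pointwise convergence on $BD_p(\Gamma)$). The map $i\colon V \to Sp(BD_p(\Gamma))$, $(i(x))(f)=f(x)$, is injective. The $p$-Royden boundary is $R_p(\Gamma) = Sp(BD_p(\Gamma)) \setminus i(V)$, and the $p$-harmonic boundary is $$\partial_p(\Gamma) = \{\chi \in R_p(\Gamma) \mid \chi(f)=0 \text{ for all } f \in B(\overline{C_c(\Gamma)}_{D_p})\}.$$ An infinite connected subset $U$ of $V$ with $\partial U \ne \emptyset$ is $D_p$-massive if there is a nonnegative function $u \in BD_p(\Gamma)$ such that $\Delta_p u(x)=0$ for all $x \in U$, $u(x)=0$ for all $x \in \partial U$, and $\sup_{x\in U} u(x)=1$. *)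

theory Defs
  imports "HOL-Analysis.Analysis"
begin

text \<open>
  A graph is given by its adjacency relation; its vertex set is the whole type \<open>'v\<close>.
\<close>

definition nbrs :: "('v \<Rightarrow> 'v \<Rightarrow> bool) \<Rightarrow> 'v \<Rightarrow> 'v set" where
  "nbrs adj x = {y. adj x y}"

definition bounded_degree :: "('v \<Rightarrow> 'v \<Rightarrow> bool) \<Rightarrow> bool" where
  "bounded_degree adj \<longleftrightarrow> (\<exists>k>0. \<forall>x. finite (nbrs adj x) \<and> card (nbrs adj x) \<le> k)"

definition outer_boundary :: "('v \<Rightarrow> 'v \<Rightarrow> bool) \<Rightarrow> 'v set \<Rightarrow> 'v set" where
  "outer_boundary adj S = {x. x \<notin> S \<and> nbrs adj x \<inter> S \<noteq> {}}"

definition connected_subset :: "('v \<Rightarrow> 'v \<Rightarrow> bool) \<Rightarrow> 'v set \<Rightarrow> bool" where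
  "connected_subset adj S \<longleftrightarrow>
     (\<forall>x\<in>S. \<forall>y\<in>S. (\<lambda>a b. a \<in> S \<and> b \<in> S \<and> adj a b)\<^sup>*\<^sup>* x y)"

definition local_energy :: "('v \<Rightarrow> 'v \<Rightarrow> bool) \<Rightarrow> real \<Rightarrow> ('v \<Rightarrow> real) \<Rightarrow> 'v \<Rightarrow> real" where
  "local_energy adj p f x = (\<Sum>y\<in>nbrs adj x. \<bar>f y - f x\<bar> powr p)"

text \<open>
  The energy $I_p(f,V)$ has nonnegative terms, so it is finite iff the family of local
  energies is summable; the real number below is meaningful only in that case.
\<close>

definition energy :: "('v \<Rightarrow> 'v \<Rightarrow> bool) \<Rightarrow> real \<Rightarrow> ('v \<Rightarrow> real) \<Rightarrow> real" where
  "energy adj p f = (\<Sum>\<^sub>\<infinity>x\<in>UNIV. local_energy adj p f x)"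

text \<open>
  For \<open>f y = f x\<close> the summand is \<open>0\<close>, also when \<open>p < 2\<close>.
\<close>

definition p_laplacian :: "('v \<Rightarrow> 'v \<Rightarrow> bool) \<Rightarrow> real \<Rightarrow> ('v \<Rightarrow> real) \<Rightarrow> 'v \<Rightarrow> real" where
  "p_laplacian adj p f x = (\<Sum>y\<in>nbrs adj x. \<bar>f y - f x\<bar> powr (p - 2) * (f y - f x))"

definition Dp :: "('v \<Rightarrow> 'v \<Rightarrow> bool) \<Rightarrow> real \<Rightarrow> ('v \<Rightarrow> real) set" where
  "Dp adj p = {f. local_energy adj p f summable_on UNIV}"

definition Dp_norm :: "('v \<Rightarrow> 'v \<Rightarrow> bool) \<Rightarrow> real \<Rightarrow> 'v \<Rightarrow> ('v \<Rightarrow> real) \<Rightarrow> real" where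
  "Dp_norm adj p v0 f = (energy adj p f + \<bar>f v0\<bar> powr p) powr (1 / p)"

definition BDp :: "('v \<Rightarrow> 'v \<Rightarrow> bool) \<Rightarrow> real \<Rightarrow> ('v \<Rightarrow> real) set" where
  "BDp adj p = {f \<in> Dp adj p. bounded (range f)}"

definition Cc :: "('v \<Rightarrow> real) set" where
  "Cc = {g. finite {x. g x \<noteq> 0}}"

definition Cc_closure :: "('v \<Rightarrow> 'v \<Rightarrow> bool) \<Rightarrow> real \<Rightarrow> 'v \<Rightarrow> ('v \<Rightarrow> real) set" where
  "Cc_closure adj p v0 =
     {f \<in> Dp adj p. \<forall>\<epsilon>>0. \<exists>g\<in>Cc. Dp_norm adj p v0 (\<lambda>x. f x - g x) < \<epsilon>}"

definition B_Cc_closure :: "('v \<Rightarrow> 'v \<Rightarrow> bool) \<Rightarrow> real \<Rightarrow> 'v \<Rightarrow> ('v \<Rightarrow> real) set" where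
  "B_Cc_closure adj p v0 = {f \<in> Cc_closure adj p v0. bounded (range f)}"

text \<open>
  Characters are functions with domain \<open>BDp adj p\<close>; extensionality makes two of them equal
  as soon as they agree on that domain, so that cardinalities come out right.
\<close>

definition Sp :: "('v \<Rightarrow> 'v \<Rightarrow> bool) \<Rightarrow> real \<Rightarrow> (('v \<Rightarrow> real) \<Rightarrow> complex) set" where
  "Sp adj p = {\<phi> \<in> extensional (BDp adj p).
     (\<forall>f\<in>BDp adj p. \<forall>g\<in>BDp adj p. \<phi> (\<lambda>x. f x + g x) = \<phi> f + \<phi> g) \<and>
     (\<forall>f\<in>BDp adj p. \<forall>g\<in>BDp adj p. \<phi> (\<lambda>x. f x * g x) = \<phi> f * \<phi> g) \<and>
     (\<forall>c. \<forall>f\<in>BDp adj p. \<phi> (\<lambda>x. c * f x) = complex_of_real c * \<phi> f) \<and>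
     (\<exists>f\<in>BDp adj p. \<phi> f \<noteq> 0)}"

definition evaluation :: "('v \<Rightarrow> 'v \<Rightarrow> bool) \<Rightarrow> real \<Rightarrow> 'v \<Rightarrow> ('v \<Rightarrow> real) \<Rightarrow> complex" where
  "evaluation adj p x = (\<lambda>f\<in>BDp adj p. complex_of_real (f x))"

definition royden_boundary ::
  "('v \<Rightarrow> 'v \<Rightarrow> bool) \<Rightarrow> real \<Rightarrow> (('v \<Rightarrow> real) \<Rightarrow> complex) set" where
  "royden_boundary adj p = Sp adj p - range (evaluation adj p)"

definition harmonic_boundary ::
  "('v \<Rightarrow> 'v \<Rightarrow> bool) \<Rightarrow> real \<Rightarrow> 'v \<Rightarrow> (('v \<Rightarrow> real) \<Rightarrow> complex) set" where
  "harmonic_boundary adj p v0 =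
     {\<phi> \<in> royden_boundary adj p. \<forall>f\<in>B_Cc_closure adj p v0. \<phi> f = 0}"

definition Dp_massive :: "('v \<Rightarrow> 'v \<Rightarrow> bool) \<Rightarrow> real \<Rightarrow> 'v set \<Rightarrow> bool" where
  "Dp_massive adj p U \<longleftrightarrow>
     infinite U \<and> connected_subset adj U \<and> outer_boundary adj U \<noteq> {} \<and>
     (\<exists>u\<in>BDp adj p. (\<forall>x. 0 \<le> u x) \<and>
        (\<forall>x\<in>U. p_laplacian adj p u x = 0) \<and>
        (\<forall>x\<in>outer_boundary adj U. u x = 0) \<and>
        (SUP x\<in>U. u x) = 1)"

end

theory Submission imports Defs begin

text \<open>
  For a massive set \<open>U\<close> with its function \<open>u\<close>, cut off outside \<open>U\<close>, there is a character in the
  harmonic boundary with value \<open>1\<close> at \<open>u\<close>. By compactness it suffices that finitely many functions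
  \<open>g\<close> from the closure of the finitely supported functions are simultaneously small at a point
  where \<open>u\<close> is close to \<open>1\<close>. Otherwise some \<open>\<bar>g\<bar>\<close> is at least \<open>\<epsilon>\<close> wherever \<open>u > s = 1 - \<epsilon>\<close>; then
  \<open>max 0 (u - s)\<close> is a limit of finitely supported functions on \<open>U\<close>, so truncating \<open>u\<close> at \<open>s\<close> does not
  lower its energy, which is absurd. Disjoint massive sets give distinct characters because the
  product of their functions is \<open>0\<close>.

  Conversely, distinct characters \<open>\<xi>\<^sub>1, \<dots>, \<xi>\<^sub>n\<close> are interpolated by one function \<open>G\<close> with
  \<open>\<xi>\<^sub>i G = i\<close>. Hat functions of \<open>G\<close> around \<open>i\<close> have disjoint supports and value \<open>1\<close> under \<open>\<xi>\<^sub>i\<close>.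
  Minimising the energy inside the support changes such a hat only by an element of the closure of
  the finitely supported functions, so the minimiser is nonzero, and a component on which it is
  nonzero is massive.
\<close>

section \<open>Powers of real numbers\<close>

text \<open>By the mean value theorem, \<open>s powr p - p * s\<close> decreases before
  \<open>1\<close> and increases after it, so \<open>1\<close> is its strict minimum on the positive
  axis. For \<open>r \<le> 0\<close> the left side is already negative.\<close>

lemma abs_powr_Bernoulli_strict:
  fixes p r :: real
  assumes p: "1 < p" and r: "r \<noteq> 1"
  shows "1 + p * (r - 1) < \<bar>r\<bar> powr p"
proof (cases "r \<le> 0")
  case True
  have "p * (r - 1) \<le> p * (-1)" using p True by (intro mult_left_mono) auto
  with p have "1 + p * (r - 1) < 0" by linarith
  also have "0 \<le> \<bar>r\<bar> powr p" by simp
  finally show ?thesis .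
next
  case False
  define g where "g = (\<lambda>s::real. s powr p - p * s)"
  have g': "(g has_real_derivative (p * s powr (p - 1) - p)) (at s)" if "s > 0" for s
    unfolding g_def using that by (auto intro!: derivative_eq_intros)
  consider "r < 1" | "1 < r" using r by linarith
  then have "g 1 < g r"
  proof cases
    case 1
    from MVT2[OF 1, of g "\<lambda>s. p * s powr (p - 1) - p"] g' False
    obtain z where z: "r < z" "z < 1" and eq: "g 1 - g r = (1 - r) * (p * z powr (p - 1) - p)"
      by auto
    have "z powr (p - 1) < 1" using powr_less_mono2[of "p - 1" z 1] z p False by auto
    then have "p * z powr (p - 1) - p < 0" using p by simp
    with eq 1 have "g 1 - g r < 0" by (simp add: mult_pos_neg)
    then show ?thesis by simp
  next
    case 2
    from MVT2[OF 2, of g "\<lambda>s. p * s powr (p - 1) - p"] g'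
    obtain z where z: "1 < z" "z < r" and eq: "g r - g 1 = (r - 1) * (p * z powr (p - 1) - p)"
      by auto
    have "1 < z powr (p - 1)" using z p by simp
    then have "0 < p * z powr (p - 1) - p" using p by simp
    with eq 2 have "0 < g r - g 1" by simp
    then show ?thesis by simp
  qed
  then show ?thesis using False by (simp add: g_def algebra_simps)
qed

text \<open>Bernoulli's inequality for \<open>r = c / a\<close>, multiplied by
  \<open>\<bar>a\<bar> powr p\<close>. The factor
  \<open>p * (\<bar>a\<bar> powr (p - 2) * a)\<close> is the derivative of
  \<open>\<bar>t\<bar> powr p\<close> at \<open>a\<close>; the first variation of the energy rests
  on this convexity.\<close>

lemma abs_powr_tangent_strict:
  fixes p a c :: real
  assumes p: "1 < p" and ac: "a \<noteq> c"
  shows "\<bar>a\<bar> powr p + p * (\<bar>a\<bar> powr (p - 2) * a * (c - a)) < \<bar>c\<bar> powr p"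
proof (cases "a = 0")
  case True
  then show ?thesis using p ac by simp
next
  case False
  have "1 + p * (c / a - 1) < \<bar>c / a\<bar> powr p"
    using abs_powr_Bernoulli_strict[OF p, of "c / a"] False ac by auto
  then have "\<bar>a\<bar> powr p * (1 + p * (c / a - 1)) < \<bar>a\<bar> powr p * \<bar>c / a\<bar> powr p"
    using False by (intro mult_strict_left_mono) auto
  moreover have "\<bar>a\<bar> powr p * \<bar>c / a\<bar> powr p = \<bar>c\<bar> powr p"
    using False by (simp add: powr_mult[symmetric])
  moreover have "\<bar>a\<bar> powr p = \<bar>a\<bar> powr (p - 2) * (a * a)"
  proof -
    have "\<bar>a\<bar> powr p = \<bar>a\<bar> powr ((p - 2) + 2)" by simp
    also have "\<dots> = \<bar>a\<bar> powr (p - 2) * \<bar>a\<bar> powr 2" by (rule powr_add)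
    also have "\<bar>a\<bar> powr 2 = a * a" using False by (simp add: power2_eq_square)
    finally show ?thesis .
  qed
  then have "\<bar>a\<bar> powr p * (c / a - 1) = \<bar>a\<bar> powr (p - 2) * a * (c - a)"
    using False by (simp add: field_simps)
  moreover have "\<bar>a\<bar> powr p * (1 + p * (c / a - 1)) = \<bar>a\<bar> powr p + p * (\<bar>a\<bar> powr p * (c / a - 1))"
    by (simp add: algebra_simps)
  ultimately show ?thesis by simp
qed

lemma abs_powr_tangent:
  fixes p a c :: real
  assumes "1 < p"
  shows "\<bar>a\<bar> powr p + p * (\<bar>a\<bar> powr (p - 2) * a * (c - a)) \<le> \<bar>c\<bar> powr p"
  using abs_powr_tangent_strict[OF assms, of a c] by (cases "a = c") auto

text \<open>The tangent inequalities at the midpoint are averaged; their linear terms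
  cancel.\<close>

lemma abs_powr_midpoint_strict:
  fixes p a b :: real
  assumes p: "1 < p" and ab: "a \<noteq> b"
  shows "\<bar>(a + b) / 2\<bar> powr p < (\<bar>a\<bar> powr p + \<bar>b\<bar> powr p) / 2"
proof -
  define m where "m = (a + b) / 2"
  define A where "A = p * (\<bar>m\<bar> powr (p - 2) * m)"
  have "\<bar>m\<bar> powr p + A * (a - m) < \<bar>a\<bar> powr p" "\<bar>m\<bar> powr p + A * (b - m) < \<bar>b\<bar> powr p"
    using abs_powr_tangent_strict[OF p, of m a] abs_powr_tangent_strict[OF p, of m b] ab
    by (auto simp: A_def m_def mult.assoc)
  moreover have "A * (a - m) + A * (b - m) = 0"
    unfolding distrib_left[symmetric] by (simp add: m_def)
  ultimately show ?thesis unfolding m_def[symmetric] by argo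
qed

lemma abs_powr_midpoint:
  fixes p a b :: real
  assumes "1 < p"
  shows "\<bar>(a + b) / 2\<bar> powr p \<le> (\<bar>a\<bar> powr p + \<bar>b\<bar> powr p) / 2"
  using abs_powr_midpoint_strict[OF assms, of a b] by (cases "a = b") auto

text \<open>Either \<open>b\<close> is small against \<open>a\<close> and is absorbed by the factor
  \<open>1 + \<epsilon>\<close>, or \<open>a\<close> is at most a multiple of \<open>b\<close>. A
  factor close to \<open>1\<close> on the first term lets energy bounds survive limits.\<close>

lemma abs_powr_add_le_eps:
  fixes p \<epsilon> :: real
  assumes p: "1 < p" and \<epsilon>: "0 < \<epsilon>"
  obtains C where "0 \<le> C" "\<And>a b. \<bar>a + b\<bar> powr p \<le> (1 + \<epsilon>) * \<bar>a\<bar> powr p + C * \<bar>b\<bar> powr p"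
proof -
  \<comment> \<open>Chosen so that \<open>(1 + \<delta>) powr p = 1 + \<epsilon>\<close>.\<close>
  define \<delta> where "\<delta> = (1 + \<epsilon>) powr (1 / p) - 1"
  have "1 < (1 + \<epsilon>) powr (1 / p)" using p \<epsilon> by simp
  then have \<delta>: "0 < \<delta>" by (simp add: \<delta>_def)
  have \<delta>p: "(1 + \<delta>) powr p = 1 + \<epsilon>" using p \<epsilon> by (simp add: \<delta>_def powr_powr)
  have "\<bar>a + b\<bar> powr p \<le> (1 + \<epsilon>) * \<bar>a\<bar> powr p + (1 + 1 / \<delta>) powr p * \<bar>b\<bar> powr p" for a b
  proof (cases "\<bar>b\<bar> \<le> \<delta> * \<bar>a\<bar>")
    case True
    then have "\<bar>a + b\<bar> \<le> (1 + \<delta>) * \<bar>a\<bar>" using abs_triangle_ineq[of a b] by (simp add: algebra_simps)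
    then have "\<bar>a + b\<bar> powr p \<le> ((1 + \<delta>) * \<bar>a\<bar>) powr p" using p by (intro powr_mono2) auto
    also have "\<dots> = (1 + \<epsilon>) * \<bar>a\<bar> powr p" using \<delta> by (simp add: powr_mult \<delta>p)
    finally show ?thesis by (simp add: add_increasing2)
  next
    case False
    then have "\<bar>a\<bar> \<le> \<bar>b\<bar> / \<delta>" using \<delta> by (simp add: field_simps)
    then have "\<bar>a + b\<bar> \<le> (1 + 1 / \<delta>) * \<bar>b\<bar>" using abs_triangle_ineq[of a b] by (simp add: algebra_simps)
    then have "\<bar>a + b\<bar> powr p \<le> ((1 + 1 / \<delta>) * \<bar>b\<bar>) powr p" using p by (intro powr_mono2) auto
    also have "\<dots> = (1 + 1 / \<delta>) powr p * \<bar>b\<bar> powr p" using \<delta> by (simp add: powr_mult)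
    finally show ?thesis using \<epsilon> by (simp add: add_increasing)
  qed
  then show ?thesis by (intro that[of "(1 + 1 / \<delta>) powr p"]) auto
qed

lemma abs_powr_add_le:
  fixes p a b :: real
  assumes p: "1 < p"
  shows "\<bar>a + b\<bar> powr p \<le> 2 powr p * (\<bar>a\<bar> powr p + \<bar>b\<bar> powr p)"
proof -
  have "\<bar>a + b\<bar> \<le> 2 * max \<bar>a\<bar> \<bar>b\<bar>" by linarith
  then have "\<bar>a + b\<bar> powr p \<le> (2 * max \<bar>a\<bar> \<bar>b\<bar>) powr p" using p by (intro powr_mono2) auto
  also have "\<dots> = 2 powr p * (max \<bar>a\<bar> \<bar>b\<bar>) powr p" by (simp add: powr_mult)
  also have "\<dots> \<le> 2 powr p * (\<bar>a\<bar> powr p + \<bar>b\<bar> powr p)"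
    by (intro mult_left_mono) (auto simp: max_def)
  finally show ?thesis .
qed

text \<open>
  Stated so that it can be summed over the edges. By homogeneity it suffices to bound the midpoint
  defect from below on a compact set.
\<close>

lemma abs_powr_uniformly_convex:
  fixes p \<epsilon> :: real
  assumes p: "1 < p" and \<epsilon>: "0 < \<epsilon>"
  obtains C where "0 \<le> C" "\<And>a b. \<bar>a - b\<bar> powr p \<le> \<epsilon> * (\<bar>a\<bar> powr p + \<bar>b\<bar> powr p)
      + C * ((\<bar>a\<bar> powr p + \<bar>b\<bar> powr p) / 2 - \<bar>(a + b) / 2\<bar> powr p)"
proof -
  define d where "d = (\<lambda>z::real\<times>real. (\<bar>fst z\<bar> powr p + \<bar>snd z\<bar> powr p) / 2 - \<bar>(fst z + snd z) / 2\<bar> powr p)"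
  \<comment> \<open>Pairs with coordinates in [-1, 1] at which the term with
    \<open>\<epsilon>\<close> alone is at most the left side. The last condition excludes the
    origin, so \<open>K\<close> avoids the diagonal and the defect \<open>d\<close> is positive on
    it.\<close>
  define K where "K = (cball 0 1 \<times> cball 0 1) \<inter>
    {z::real\<times>real. \<epsilon> * (\<bar>fst z\<bar> powr p + \<bar>snd z\<bar> powr p) \<le> \<bar>fst z - snd z\<bar> powr p} \<inter>
    {z. 1 \<le> \<bar>fst z\<bar> powr p + \<bar>snd z\<bar> powr p}"
  have cont: "continuous_on UNIV d" unfolding d_def using p
    by (intro continuous_intros continuous_on_powr') auto
  have "compact K" unfolding K_def using p
    by (intro compact_Int_closed compact_Times closed_Collect_le continuous_intros continuous_on_powr') auto
  have pos: "0 < d z" if "z \<in> K" for z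
  proof -
    have "fst z \<noteq> snd z"
    proof
      assume "fst z = snd z"
      then have "\<epsilon> * (\<bar>fst z\<bar> powr p + \<bar>snd z\<bar> powr p) \<le> 0" "1 \<le> \<bar>fst z\<bar> powr p + \<bar>snd z\<bar> powr p"
        using that by (auto simp: K_def)
      then show False using \<epsilon> by (simp add: mult_le_0_iff)
    qed
    from abs_powr_midpoint_strict[OF p this] show ?thesis by (simp add: d_def)
  qed
  obtain \<delta> where \<delta>: "0 < \<delta>" "\<And>z. z \<in> K \<Longrightarrow> \<delta> \<le> d z"
  proof (cases "K = {}")
    case True
    then show ?thesis using that[of 1] by auto
  next
    case False
    from continuous_attains_inf[OF \<open>compact K\<close> False continuous_on_subset[OF cont]]
    obtain z where "z \<in> K" "\<forall>y\<in>K. d z \<le> d y" by auto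
    then show ?thesis using that[of "d z"] pos by auto
  qed
  \<comment> \<open>On \<open>K\<close> the defect is at least \<open>\<delta>\<close>, while
    \<open>\<bar>x - y\<bar> powr p\<close> is at most \<open>2 powr p\<close>.\<close>
  define C where "C = 2 powr p / \<delta>"
  have C: "0 \<le> C" using \<delta> by (simp add: C_def)
  have "\<bar>a - b\<bar> powr p \<le> \<epsilon> * (\<bar>a\<bar> powr p + \<bar>b\<bar> powr p) + C * d (a, b)" for a b
  proof (cases "\<bar>a - b\<bar> powr p \<le> \<epsilon> * (\<bar>a\<bar> powr p + \<bar>b\<bar> powr p)")
    case True
    have "0 \<le> d (a, b)" using abs_powr_midpoint[OF p, of a b] by (simp add: d_def)
    with C have "0 \<le> C * d (a, b)" by simp
    with True show ?thesis by simp
  next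
    case False
    \<comment> \<open>Dividing by the larger modulus brings the pair into \<open>K\<close>; all
      terms are homogeneous of degree \<open>p\<close>.\<close>
    define M where "M = max \<bar>a\<bar> \<bar>b\<bar>"
    have "M > 0"
    proof (rule ccontr)
      assume "\<not> M > 0"
      then have "a = 0" "b = 0" by (auto simp: M_def)
      with False show False by simp
    qed
    have hom: "\<bar>M * t\<bar> powr p = M powr p * \<bar>t\<bar> powr p" for t
      using \<open>M > 0\<close> by (simp add: abs_mult powr_mult)
    define x y where "x = a / M" and "y = b / M"
    have ab: "a = M * x" "b = M * y" using \<open>M > 0\<close> by (auto simp: x_def y_def)
    have le1: "\<bar>x\<bar> \<le> 1" "\<bar>y\<bar> \<le> 1" using \<open>M > 0\<close> by (auto simp: x_def y_def M_def)
    have "\<bar>x\<bar> = 1 \<or> \<bar>y\<bar> = 1" using \<open>M > 0\<close> by (auto simp: x_def y_def M_def max_def split: if_splits)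
    then have ge1: "1 \<le> \<bar>x\<bar> powr p + \<bar>y\<bar> powr p" by auto
    have diff: "\<bar>a - b\<bar> powr p = M powr p * \<bar>x - y\<bar> powr p"
      unfolding hom[symmetric] by (simp add: ab right_diff_distrib)
    have "M powr p * (\<epsilon> * (\<bar>x\<bar> powr p + \<bar>y\<bar> powr p)) \<le> M powr p * \<bar>x - y\<bar> powr p"
      using False unfolding diff unfolding ab hom by (simp add: algebra_simps)
    then have "\<epsilon> * (\<bar>x\<bar> powr p + \<bar>y\<bar> powr p) \<le> \<bar>x - y\<bar> powr p"
      using \<open>M > 0\<close> by simp
    with le1 ge1 have "(x, y) \<in> K" by (auto simp: K_def)
    then have "\<delta> \<le> d (x, y)" by (rule \<delta>)
    have "\<bar>x - y\<bar> \<le> 2" using le1 by linarith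
    then have "\<bar>x - y\<bar> powr p \<le> 2 powr p" using p by (intro powr_mono2) auto
    also have "\<dots> = C * \<delta>" using \<delta> by (simp add: C_def)
    also have "\<dots> \<le> C * d (x, y)" using C \<open>\<delta> \<le> d (x, y)\<close> by (rule mult_left_mono[rotated])
    finally have "\<bar>a - b\<bar> powr p \<le> M powr p * (C * d (x, y))"
      unfolding diff by (intro mult_left_mono) auto
    also have "\<dots> = C * d (a, b)"
    proof -
      have "(a + b) / 2 = M * ((x + y) / 2)" by (simp add: ab distrib_left)
      then show ?thesis unfolding d_def fst_conv snd_conv by (simp only: hom ab) (simp add: algebra_simps)
    qed
    finally show ?thesis using \<epsilon> by (simp add: add_increasing)
  qed
  with C show ?thesis by (intro that[of C]) (auto simp: d_def)
qed

text \<open>For \<open>p < 2\<close> the first factor is unbounded near \<open>0\<close>. Rewriting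
  the product through powers of the positive and negative parts leaves only the positive exponent
  \<open>p - 1\<close>.\<close>

lemma isCont_abs_powr_mult:
  fixes p :: real
  assumes p: "1 < p"
  shows "isCont (\<lambda>t. \<bar>t\<bar> powr (p - 2) * t) a"
proof -
  have eq: "(\<lambda>t::real. \<bar>t\<bar> powr (p - 2) * t) = (\<lambda>t. max t 0 powr (p - 1) - max (- t) 0 powr (p - 1))"
  proof
    fix t :: real
    have "s powr (p - 2) * s = s powr (p - 1)" if "s > 0" for s :: real
      using that powr_add[of s "p - 2" 1] by simp
    from this[of t] this[of "- t"] show "\<bar>t\<bar> powr (p - 2) * t = max t 0 powr (p - 1) - max (- t) 0 powr (p - 1)"
      using p by (cases "t > 0"; cases "t = 0") (auto simp: max_def)
  qed
  have "continuous_on UNIV (\<lambda>t::real. max t 0 powr (p - 1) - max (- t) 0 powr (p - 1))"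
    using p by (intro continuous_intros continuous_on_powr') auto
  then show ?thesis unfolding eq by (simp add: continuous_on_eq_continuous_at)
qed

section \<open>Energy and the first variation\<close>

text \<open>Dominated convergence with a varying majorant: a fixed summable part plus a part whose
  sums tend to \<open>0\<close>. A finite set carrying most of \<open>a\<close> is treated
  pointwise, the rest by the majorant.\<close>

lemma infsum_tendsto_zero_dominated:
  fixes A b :: "nat \<Rightarrow> 'v \<Rightarrow> real" and a :: "'v \<Rightarrow> real"
  assumes A0: "\<And>k x. 0 \<le> A k x" and dom: "\<And>k x. A k x \<le> a x + b k x"
    and a0: "\<And>x. 0 \<le> a x" and a: "a summable_on UNIV"
    and b0: "\<And>k x. 0 \<le> b k x" and b: "\<And>k. b k summable_on UNIV"
    and blim: "(\<lambda>k. \<Sum>\<^sub>\<infinity>x. b k x) \<longlonglongrightarrow> 0" and Alim: "\<And>x. (\<lambda>k. A k x) \<longlonglongrightarrow> 0"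
  shows "(\<lambda>k. \<Sum>\<^sub>\<infinity>x. A k x) \<longlonglongrightarrow> 0"
proof (rule LIMSEQ_I)
  fix \<epsilon> :: real assume \<epsilon>: "0 < \<epsilon>"
  have ab: "(\<lambda>x. a x + b k x) summable_on UNIV" for k by (intro summable_on_add a b)
  have Ak: "A k summable_on UNIV" for k
    by (rule summable_on_comparison_test[OF ab]) (use dom A0 in auto)
  have sub: "f summable_on B" if "f summable_on UNIV" for f :: "'v \<Rightarrow> real" and B
    using that by (rule summable_on_subset_banach) auto
  \<comment> \<open>The finite part, the tail of \<open>a\<close> and the sum of \<open>b k\<close>
    contribute at most \<open>\<epsilon> / 4\<close> each.\<close>
  obtain S where S: "finite S" "dist (sum a S) (infsum a UNIV) \<le> \<epsilon> / 4"
    using infsum_finite_approximation[OF a, of "\<epsilon> / 4"] \<epsilon> by auto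
  have split: "infsum f UNIV = sum f S + infsum f (- S)" if "f summable_on UNIV" for f :: "'v \<Rightarrow> real"
    using infsum_Un_disjoint[of f S "- S"] sub[OF that] S by (simp add: Compl_partition)
  have tail: "infsum a (- S) \<le> \<epsilon> / 4" using S(2) split[OF a] by (simp add: dist_real_def)
  have "(\<lambda>k. \<Sum>x\<in>S. A k x) \<longlonglongrightarrow> 0" using Alim by (intro tendsto_null_sum) auto
  then have "eventually (\<lambda>k. (\<Sum>x\<in>S. A k x) < \<epsilon> / 4) sequentially"
    by (rule order_tendstoD) (use \<epsilon> in auto)
  moreover have "eventually (\<lambda>k. infsum (b k) UNIV < \<epsilon> / 4) sequentially"
    using blim by (rule order_tendstoD) (use \<epsilon> in auto)
  ultimately have "eventually (\<lambda>k. norm (infsum (A k) UNIV - 0) < \<epsilon>) sequentially"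
  proof eventually_elim
    case (elim k)
    have "infsum (A k) (- S) \<le> infsum (\<lambda>x. a x + b k x) (- S)"
      by (rule infsum_mono) (use sub Ak ab dom in auto)
    also have "\<dots> = infsum a (- S) + infsum (b k) (- S)"
      by (rule infsum_add) (use sub a b in auto)
    also have "infsum (b k) (- S) \<le> infsum (b k) UNIV"
      by (rule infsum_mono2) (use sub b b0 in auto)
    finally have "infsum (A k) UNIV < \<epsilon>" using tail elim split[OF Ak[of k]] \<epsilon> by linarith
    moreover have "0 \<le> infsum (A k) UNIV" by (rule infsum_nonneg) (use A0 in auto)
    ultimately show ?case by simp
  qed
  then show "\<exists>no. \<forall>k\<ge>no. norm (infsum (A k) UNIV - 0) < \<epsilon>"
    by (simp add: eventually_sequentially)
qed

lemma
  fixes f :: "'i \<Rightarrow> 'v \<Rightarrow> real"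
  assumes T: "finite T" and f: "\<And>i. i \<in> T \<Longrightarrow> f i summable_on A"
  shows summable_on_sum: "(\<lambda>x. \<Sum>i\<in>T. f i x) summable_on A"
    and infsum_sum: "infsum (\<lambda>x. \<Sum>i\<in>T. f i x) A = (\<Sum>i\<in>T. infsum (f i) A)"
proof -
  have "((\<lambda>x. \<Sum>i\<in>T. f i x) has_sum (\<Sum>i\<in>T. infsum (f i) A)) A"
    using T f by (induction T) (auto intro!: has_sum_add)
  then show "(\<lambda>x. \<Sum>i\<in>T. f i x) summable_on A"
    and "infsum (\<lambda>x. \<Sum>i\<in>T. f i x) A = (\<Sum>i\<in>T. infsum (f i) A)"
    by (auto simp: summable_on_def infsumI)
qed

lemma le_of_le_one_plus_eps:
  fixes c B :: real
  assumes "\<And>\<epsilon>. 0 < \<epsilon> \<Longrightarrow> c \<le> (1 + \<epsilon>) * B"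
  shows "c \<le> B"
proof -
  have "(\<lambda>n. (1 + inverse (real (Suc n))) * B) \<longlonglongrightarrow> (1 + 0) * B"
    by (intro tendsto_intros LIMSEQ_inverse_real_of_nat)
  then show ?thesis using assms by (intro LIMSEQ_le_const[of _ B]) auto
qed

section \<open>Energy on a locally finite connected graph\<close>

locale p_graph =
  fixes adj :: "'v \<Rightarrow> 'v \<Rightarrow> bool" and p :: real
  assumes p: "1 < p"
    and adj_sym: "adj x y \<Longrightarrow> adj y x"
    and connected: "connected_subset adj UNIV"
    and finite_nbrs: "finite (nbrs adj x)"
begin

abbreviation "L \<equiv> local_energy adj p"
abbreviation "E \<equiv> energy adj p"
abbreviation "Lap \<equiv> p_laplacian adj p"

lemma in_nbrs [simp]: "y \<in> nbrs adj x \<longleftrightarrow> adj x y"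
  by (simp add: nbrs_def)

lemma Dp_iff: "f \<in> Dp adj p \<longleftrightarrow> L f summable_on UNIV"
  by (simp add: Dp_def)

lemma local_energy_nonneg: "0 \<le> L f x"
  unfolding local_energy_def by (rule sum_nonneg) auto

lemma energy_nonneg: "0 \<le> E f"
  unfolding energy_def by (rule infsum_nonneg) (rule local_energy_nonneg)

lemma local_energy_le_energy: "f \<in> Dp adj p \<Longrightarrow> L f x \<le> E f"
  using finite_sum_le_infsum[of "L f" UNIV "{x}"] local_energy_nonneg
  by (simp add: Dp_iff energy_def)

lemma edge_le_local_energy: "adj x y \<Longrightarrow> \<bar>f y - f x\<bar> powr p \<le> L f x"
  unfolding local_energy_def using finite_nbrs
  by (intro member_le_sum[of y "nbrs adj x" "\<lambda>y. \<bar>f y - f x\<bar> powr p"]) auto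

lemma edge_le_energy: "f \<in> Dp adj p \<Longrightarrow> adj x y \<Longrightarrow> \<bar>f y - f x\<bar> powr p \<le> E f"
  using edge_le_local_energy local_energy_le_energy by (rule order_trans)

lemma Dp_dominated:
  assumes "\<And>x. L f x \<le> b x" "b summable_on UNIV"
  shows "f \<in> Dp adj p" "E f \<le> infsum b UNIV"
proof -
  show *: "f \<in> Dp adj p" unfolding Dp_iff
    by (rule summable_on_comparison_test[OF assms(2)]) (use assms(1) local_energy_nonneg in auto)
  show "E f \<le> infsum b UNIV" unfolding energy_def
    by (rule infsum_mono) (use * assms in \<open>auto simp: Dp_iff\<close>)
qed

lemma local_energy_le_mult:
  assumes "0 \<le> K" "\<And>y. adj x y \<Longrightarrow> \<bar>f y - f x\<bar> \<le> K * \<bar>g y - g x\<bar>"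
  shows "L f x \<le> K powr p * L g x"
proof -
  have "\<bar>f y - f x\<bar> powr p \<le> K powr p * \<bar>g y - g x\<bar> powr p" if "adj x y" for y
  proof -
    have "\<bar>f y - f x\<bar> powr p \<le> (K * \<bar>g y - g x\<bar>) powr p"
      using assms(2)[OF that] p by (intro powr_mono2) auto
    then show ?thesis using assms(1) by (simp add: powr_mult)
  qed
  then show ?thesis unfolding local_energy_def sum_distrib_left by (intro sum_mono) simp
qed

text \<open>The common source of membership in \<open>Dp\<close> for truncations, scalar multiples
  and Lipschitz images.\<close>

lemma Dp_lipschitz:
  assumes "g \<in> Dp adj p" "0 \<le> K" "\<And>x y. adj x y \<Longrightarrow> \<bar>f y - f x\<bar> \<le> K * \<bar>g y - g x\<bar>"
  shows "f \<in> Dp adj p" "E f \<le> K powr p * E g"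
proof -
  have le: "L f x \<le> K powr p * L g x" for x using assms by (intro local_energy_le_mult) auto
  have s: "(\<lambda>x. K powr p * L g x) summable_on UNIV"
    using assms(1) by (intro summable_on_cmult_right) (simp add: Dp_iff)
  show "f \<in> Dp adj p" using Dp_dominated(1)[OF le s] .
  show "E f \<le> K powr p * E g"
    using Dp_dominated(2)[OF le s] assms(1) by (simp add: energy_def infsum_cmult_right Dp_iff)
qed

lemma local_energy_add_le: "L (\<lambda>x. f x + g x) x \<le> 2 powr p * (L f x + L g x)"
  unfolding local_energy_def sum.distrib[symmetric] sum_distrib_left
proof (rule sum_mono)
  fix y
  show "\<bar>f y + g y - (f x + g x)\<bar> powr p \<le> 2 powr p * (\<bar>f y - f x\<bar> powr p + \<bar>g y - g x\<bar> powr p)"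
    using abs_powr_add_le[OF p, of "f y - f x" "g y - g x"] by (simp add: algebra_simps)
qed

lemma Dp_add: "f \<in> Dp adj p \<Longrightarrow> g \<in> Dp adj p \<Longrightarrow> (\<lambda>x. f x + g x) \<in> Dp adj p"
  by (rule Dp_dominated(1)[OF local_energy_add_le])
     (auto simp: Dp_iff intro!: summable_on_cmult_right summable_on_add)

lemma Dp_cmult: "f \<in> Dp adj p \<Longrightarrow> (\<lambda>x. c * f x) \<in> Dp adj p"
  by (rule Dp_lipschitz(1)[of f "\<bar>c\<bar>"]) (auto simp: abs_mult[symmetric] right_diff_distrib)

lemma Dp_diff: "f \<in> Dp adj p \<Longrightarrow> g \<in> Dp adj p \<Longrightarrow> (\<lambda>x. f x - g x) \<in> Dp adj p"
  using Dp_add[of f "\<lambda>x. -1 * g x"] Dp_cmult[of g "-1"] by simp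

lemma local_energy_eq_0: "(\<And>y. adj x y \<Longrightarrow> f y = f x) \<Longrightarrow> L f x = 0"
  unfolding local_energy_def by (intro sum.neutral) auto

lemma Dp_const: "(\<lambda>_. c) \<in> Dp adj p"
  by (simp add: Dp_iff local_energy_eq_0 summable_on_cong[where g = "\<lambda>_. 0"])

lemma Cc_subset_Dp: assumes "\<phi> \<in> Cc" shows "\<phi> \<in> Dp adj p"
proof -
  define T where "T = {x. \<phi> x \<noteq> 0}"
  have T: "finite T" using assms by (simp add: Cc_def T_def)
  define S where "S = T \<union> (\<Union>x\<in>T. nbrs adj x)"
  have "finite S" using T finite_nbrs by (auto simp: S_def)
  then have "L \<phi> summable_on S" by simp
  moreover have "L \<phi> x = 0" if "x \<notin> S" for x
    using that by (intro local_energy_eq_0) (auto simp: S_def T_def dest: adj_sym)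
  ultimately show ?thesis unfolding Dp_iff
    by (rule summable_on_cong_neutral[THEN iffD1, rotated 3]) auto
qed

lemma Cc_delta: "(\<lambda>x. if x = z then c else 0) \<in> Cc"
  by (simp add: Cc_def)

text \<open>The constant does not depend on the functions, so it stays fixed while a sequence in
  place of \<open>g\<close> tends to \<open>0\<close> in energy.\<close>

lemma energy_add_le_eps:
  assumes "0 < \<epsilon>"
  obtains C where "0 \<le> C" "\<And>f g. f \<in> Dp adj p \<Longrightarrow> g \<in> Dp adj p \<Longrightarrow>
    E (\<lambda>x. f x + g x) \<le> (1 + \<epsilon>) * E f + C * E g"
proof -
  obtain C where C: "0 \<le> C" "\<And>a b. \<bar>a + b\<bar> powr p \<le> (1 + \<epsilon>) * \<bar>a\<bar> powr p + C * \<bar>b\<bar> powr p"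
    using abs_powr_add_le_eps[OF p assms] by blast
  have "E (\<lambda>x. f x + g x) \<le> (1 + \<epsilon>) * E f + C * E g"
    if "f \<in> Dp adj p" "g \<in> Dp adj p" for f g
  proof -
    have le: "L (\<lambda>x. f x + g x) x \<le> (1 + \<epsilon>) * L f x + C * L g x" for x
      unfolding local_energy_def sum_distrib_left sum.distrib[symmetric]
    proof (rule sum_mono)
      fix y
      show "\<bar>f y + g y - (f x + g x)\<bar> powr p \<le> (1 + \<epsilon>) * \<bar>f y - f x\<bar> powr p + C * \<bar>g y - g x\<bar> powr p"
        using C(2)[of "f y - f x" "g y - g x"] by (simp add: algebra_simps)
    qed
    have "E (\<lambda>x. f x + g x) \<le> (\<Sum>\<^sub>\<infinity>x. (1 + \<epsilon>) * L f x + C * L g x)"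
      by (rule Dp_dominated(2)[OF le]) (use that in \<open>auto simp: Dp_iff intro!: summable_on_cmult_right summable_on_add\<close>)
    also have "\<dots> = (1 + \<epsilon>) * E f + C * E g" using that
      by (subst infsum_add) (auto simp: Dp_iff energy_def infsum_cmult_right intro!: summable_on_cmult_right)
    finally show ?thesis .
  qed
  with C(1) show ?thesis by (intro that[of C]) auto
qed

lemma energy_diff_commute: "E (\<lambda>x. f x - g x) = E (\<lambda>x. g x - f x)"
proof -
  have "\<bar>f y - g y - (f x - g x)\<bar> = \<bar>g y - f y - (g x - f x)\<bar>" for x y by linarith
  then show ?thesis by (simp add: energy_def local_energy_def)
qed

text \<open>Write \<open>F k\<close> as \<open>g\<close> plus the difference and let
  \<open>k\<close> tend to infinity at fixed \<open>\<epsilon>\<close>; then let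
  \<open>\<epsilon>\<close> tend to \<open>0\<close>.\<close>

lemma energy_limit_ge:
  assumes F: "\<And>k. F k \<in> Dp adj p" and g: "g \<in> Dp adj p"
    and lim: "(\<lambda>k. E (\<lambda>x. F k x - g x)) \<longlonglongrightarrow> 0" and c: "\<And>k. c \<le> E (F k)"
  shows "c \<le> E g"
proof (rule le_of_le_one_plus_eps)
  fix \<epsilon> :: real assume "0 < \<epsilon>"
  then obtain C where C: "0 \<le> C" "\<And>f g. f \<in> Dp adj p \<Longrightarrow> g \<in> Dp adj p \<Longrightarrow>
    E (\<lambda>x. f x + g x) \<le> (1 + \<epsilon>) * E f + C * E g"
    using energy_add_le_eps by blast
  have "c \<le> (1 + \<epsilon>) * E g + C * E (\<lambda>x. F k x - g x)" for k
    using C(2)[OF g Dp_diff[OF F g, of k]] c[of k] by simp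
  moreover have "(\<lambda>k. (1 + \<epsilon>) * E g + C * E (\<lambda>x. F k x - g x)) \<longlonglongrightarrow> (1 + \<epsilon>) * E g + C * 0"
    by (intro tendsto_intros lim)
  ultimately show "c \<le> (1 + \<epsilon>) * E g" using LIMSEQ_le_const by fastforce
qed

text \<open>The same argument with the roles of \<open>F k\<close> and \<open>g\<close>
  exchanged.\<close>

lemma energy_limit_le:
  assumes F: "\<And>k. F k \<in> Dp adj p" and g: "g \<in> Dp adj p"
    and lim: "(\<lambda>k. E (\<lambda>x. F k x - g x)) \<longlonglongrightarrow> 0" and c: "(\<lambda>k. E (F k)) \<longlonglongrightarrow> c"
  shows "E g \<le> c"
proof (rule le_of_le_one_plus_eps)
  fix \<epsilon> :: real assume "0 < \<epsilon>"
  then obtain C where C: "0 \<le> C" "\<And>f g. f \<in> Dp adj p \<Longrightarrow> g \<in> Dp adj p \<Longrightarrow>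
    E (\<lambda>x. f x + g x) \<le> (1 + \<epsilon>) * E f + C * E g"
    using energy_add_le_eps by blast
  have "E g \<le> (1 + \<epsilon>) * E (F k) + C * E (\<lambda>x. F k x - g x)" for k
    using C(2)[OF F Dp_diff[OF g F], of k k] energy_diff_commute[of g "F k"] by simp
  moreover have "(\<lambda>k. (1 + \<epsilon>) * E (F k) + C * E (\<lambda>x. F k x - g x)) \<longlonglongrightarrow> (1 + \<epsilon>) * c + C * 0"
    by (intro tendsto_intros lim c)
  ultimately show "E g \<le> (1 + \<epsilon>) * c" using LIMSEQ_le_const by fastforce
qed

text \<open>
  Summation by parts: each edge is counted in both directions, whence the factor \<open>2\<close>.
\<close>

lemma energy_first_variation:
  assumes w: "w \<in> Dp adj p" and \<phi>: "\<phi> \<in> Cc"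
  shows "E w - 2 * p * (\<Sum>x | \<phi> x \<noteq> 0. \<phi> x * Lap w x) \<le> E (\<lambda>x. w x + \<phi> x)"
proof -
  define T where "T = {x. \<phi> x \<noteq> 0}"
  have T: "finite T" using \<phi> by (simp add: Cc_def T_def)
  \<comment> \<open>Away from the support of \<open>\<phi>\<close> and its neighbours all
    differences of \<open>\<phi>\<close> vanish, so the variation \<open>D\<close> has a finite
    sum.\<close>
  define S where "S = T \<union> (\<Union>x\<in>T. nbrs adj x)"
  have S: "finite S" using T finite_nbrs by (auto simp: S_def)
  define a where "a = (\<lambda>x y. \<bar>w y - w x\<bar> powr (p - 2) * (w y - w x))"
  have anti: "a x y = - a y x" for x y
    unfolding a_def abs_minus_commute[of "w y"] by (simp add: algebra_simps)
  have Lap: "Lap w x = (\<Sum>y\<in>nbrs adj x. a x y)" for x by (simp add: p_laplacian_def a_def)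
  define D where "D = (\<lambda>x. \<Sum>y\<in>nbrs adj x. a x y * (\<phi> y - \<phi> x))"
  have D0: "D x = 0" if "x \<notin> S" for x
  proof -
    have "\<phi> x = 0" using that by (auto simp: S_def T_def)
    moreover have "\<phi> y = 0" if "adj x y" for y
      using adj_sym[OF that] \<open>x \<notin> S\<close> by (auto simp: S_def T_def)
    ultimately show ?thesis unfolding D_def by (intro sum.neutral) auto
  qed
  \<comment> \<open>The tangent inequality on every oriented edge.\<close>
  have le: "L w x + p * D x \<le> L (\<lambda>x. w x + \<phi> x) x" for x
    unfolding local_energy_def D_def sum_distrib_left sum.distrib[symmetric]
  proof (rule sum_mono)
    fix y
    show "\<bar>w y - w x\<bar> powr p + p * (a x y * (\<phi> y - \<phi> x)) \<le> \<bar>w y + \<phi> y - (w x + \<phi> x)\<bar> powr p"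
      using abs_powr_tangent[OF p, of "w y - w x" "w y + \<phi> y - (w x + \<phi> x)"]
      by (simp add: a_def algebra_simps)
  qed
  have hs: "(D has_sum sum D S) UNIV"
    using has_sum_cong_neutral[of S UNIV D D "sum D S"] D0 S by (auto simp: has_sum_finiteI)
  then have Ds: "D summable_on UNIV" and Di: "infsum D UNIV = sum D S"
    by (auto simp: summable_on_def infsumI)
  have "E w + p * sum D S = (\<Sum>\<^sub>\<infinity>x. L w x + p * D x)"
    using w Ds Di by (subst infsum_add) (auto simp: Dp_iff energy_def infsum_cmult_right intro!: summable_on_cmult_right)
  also have "\<dots> \<le> E (\<lambda>x. w x + \<phi> x)" unfolding energy_def
    using w Dp_add[OF w Cc_subset_Dp[OF \<phi>]] Ds le
    by (intro infsum_mono) (auto simp: Dp_iff intro!: summable_on_add summable_on_cmult_right)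
  finally have *: "E w + p * sum D S \<le> E (\<lambda>x. w x + \<phi> x)" .
  \<comment> \<open>Swapping the sums and using that \<open>a\<close> is antisymmetric turns the
    terms with \<open>\<phi> y\<close> into minus the sum of \<open>\<phi> y * Lap w y\<close>. The
    terms with \<open>\<phi> x\<close> enter \<open>D\<close> with a minus sign and double
    it.\<close>
  have "(\<Sum>x\<in>S. \<Sum>y\<in>nbrs adj x. a x y * \<phi> y) = (\<Sum>x\<in>S. \<Sum>y\<in>T. if adj x y then a x y * \<phi> y else 0)"
    using finite_nbrs T by (intro sum.cong sum.mono_neutral_cong) (auto simp: T_def)
  also have "\<dots> = (\<Sum>y\<in>T. \<Sum>x\<in>S. if adj x y then a x y * \<phi> y else 0)" by (rule sum.swap)
  also have "\<dots> = (\<Sum>y\<in>T. \<Sum>x\<in>nbrs adj y. - (\<phi> y * a y x))"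
  proof (rule sum.cong[OF refl])
    fix y assume y: "y \<in> T"
    have eq: "a x y * \<phi> y = - (\<phi> y * a y x)" for x using anti[of x y] by simp
    have adj: "adj x y \<longleftrightarrow> adj y x" for x using adj_sym by blast
    show "(\<Sum>x\<in>S. if adj x y then a x y * \<phi> y else 0) = (\<Sum>x\<in>nbrs adj y. - (\<phi> y * a y x))"
      unfolding eq adj using S finite_nbrs y by (intro sum.mono_neutral_cong) (auto simp: S_def)
  qed
  also have "\<dots> = - (\<Sum>y\<in>T. \<phi> y * Lap w y)"
    by (simp add: Lap sum_negf sum_distrib_left)
  finally have 1: "(\<Sum>x\<in>S. \<Sum>y\<in>nbrs adj x. a x y * \<phi> y) = - (\<Sum>y\<in>T. \<phi> y * Lap w y)" .
  have "(\<Sum>x\<in>S. \<Sum>y\<in>nbrs adj x. a x y * \<phi> x) = (\<Sum>x\<in>S. \<phi> x * Lap w x)"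
    by (simp add: Lap sum_distrib_left mult.commute)
  also have "\<dots> = (\<Sum>y\<in>T. \<phi> y * Lap w y)"
    using S by (intro sum.mono_neutral_right) (auto simp: S_def T_def)
  finally have "sum D S = - 2 * (\<Sum>y\<in>T. \<phi> y * Lap w y)"
    using 1 by (simp add: D_def right_diff_distrib sum_subtractf)
  with * show ?thesis by (simp add: T_def)
qed

text \<open>By convexity a critical point is a minimum: the linear term of the first variation
  vanishes.\<close>

lemma energy_le_add_Cc:
  assumes "w \<in> Dp adj p" "\<phi> \<in> Cc" "\<And>x. \<phi> x \<noteq> 0 \<Longrightarrow> Lap w x = 0"
  shows "E w \<le> E (\<lambda>x. w x + \<phi> x)"
proof -
  have "(\<Sum>x | \<phi> x \<noteq> 0. \<phi> x * Lap w x) = 0" using assms(3) by (intro sum.neutral) auto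
  with energy_first_variation[OF assms(1,2)] show ?thesis by simp
qed

section \<open>Connectedness and the maximum principle\<close>

lemma connected_induct:
  assumes "P x" "\<And>x y. P x \<Longrightarrow> adj x y \<Longrightarrow> P y"
  shows "P y"
proof -
  have "(\<lambda>a b. a \<in> UNIV \<and> b \<in> UNIV \<and> adj a b)\<^sup>*\<^sup>* x y"
    using connected by (simp add: connected_subset_def)
  then show ?thesis by (induction rule: rtranclp_induct) (use assms in auto)
qed

text \<open>
  A harmonic function that vanishes outside \<open>D\<close> minimises the energy among its perturbations
  inside \<open>D\<close>; truncating it from above at \<open>s\<close> strictly lowers the energy unless nothing is cut off.
\<close>

lemma harmonic_le_of_approx:
  assumes w: "w \<in> Dp adj p" and harm: "\<And>x. x \<in> D \<Longrightarrow> Lap w x = 0"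
    and z: "w z \<le> s"
    and \<phi>: "\<And>k. \<phi> k \<in> Cc" "\<And>k x. x \<notin> D \<Longrightarrow> \<phi> k x = 0"
    and lim: "(\<lambda>k. E (\<lambda>x. \<phi> k x - max 0 (w x - s))) \<longlonglongrightarrow> 0"
  shows "w x \<le> s"
proof -
  define m where "m = (\<lambda>x. min (w x) s)"
  have m_lip: "\<bar>m y - m x\<bar> \<le> 1 * \<bar>w y - w x\<bar>" for x y by (auto simp: m_def min_def)
  have m: "m \<in> Dp adj p" by (rule Dp_lipschitz(1)[OF w _ m_lip]) auto
  \<comment> \<open>The competitors \<open>w - \<phi> k\<close> have at least the energy of
    \<open>w\<close>, since \<open>w\<close> is harmonic where \<open>\<phi> k\<close> is nonzero,
    and they converge in energy to the truncation \<open>m\<close>.\<close>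
  have "E w \<le> E m"
  proof (rule energy_limit_ge[where F = "\<lambda>k x. w x - \<phi> k x"])
    show "(\<lambda>x. w x - \<phi> k x) \<in> Dp adj p" for k by (intro Dp_diff w Cc_subset_Dp \<phi>)
    show "m \<in> Dp adj p" by fact
    have "E (\<lambda>x. w x - \<phi> k x - m x) = E (\<lambda>x. \<phi> k x - max 0 (w x - s))" for k
    proof -
      have "(\<lambda>x. w x - \<phi> k x - m x) = (\<lambda>x. max 0 (w x - s) - \<phi> k x)" by (auto simp: m_def)
      then show ?thesis by (simp only: energy_diff_commute[of "\<phi> k"])
    qed
    then show "(\<lambda>k. E (\<lambda>x. w x - \<phi> k x - m x)) \<longlonglongrightarrow> 0" using lim by simp
    fix k
    have "(\<lambda>x. - \<phi> k x) \<in> Cc" using \<phi>(1)[of k] by (simp add: Cc_def)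
    moreover have "Lap w x = 0" if "- \<phi> k x \<noteq> 0" for x
    proof -
      from that \<phi>(2)[of x k] have "x \<in> D" by auto
      then show ?thesis by (rule harm)
    qed
    ultimately have "E w \<le> E (\<lambda>x. w x + - \<phi> k x)" by (rule energy_le_add_Cc[OF w])
    then show "E w \<le> E (\<lambda>x. w x - \<phi> k x)" by simp
  qed
  have Lle: "L m x \<le> L w x" for x
    using local_energy_le_mult[of 1 x m w] m_lip by auto
  \<comment> \<open>On an edge leaving the set where \<open>w \<le> s\<close>, truncation strictly
    shortens the difference, which would make \<open>E m\<close> smaller than \<open>E w\<close>. So
    this set is closed under neighbours, and it contains \<open>z\<close>.\<close>
  have step: "w y \<le> s" if "w x \<le> s" "adj x y" for x y
  proof (rule ccontr)
    assume "\<not> w y \<le> s"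
    then have "\<bar>m y - m x\<bar> < \<bar>w y - w x\<bar>" using that by (auto simp: m_def min_def)
    then have "\<bar>m y - m x\<bar> powr p < \<bar>w y - w x\<bar> powr p" using p by (intro powr_less_mono2) auto
    then have "L m x < L w x" unfolding local_energy_def using finite_nbrs m_lip p that
      by (intro sum_strict_mono_ex1) (auto intro!: powr_mono2)
    moreover have "(L m has_sum E m) UNIV" "(L w has_sum E w) UNIV"
      using w m by (auto simp: Dp_iff energy_def)
    ultimately have "E m < E w" using Lle by (intro has_sum_strict_mono[where f = "L m" and a = "E m" and A = UNIV and g = "L w" and b = "E w" and x = x]) auto
    with \<open>E w \<le> E m\<close> show False by simp
  qed
  show ?thesis by (rule connected_induct[where P = "\<lambda>x. w x \<le> s", OF z step])
qed

section \<open>Harmonic functions and the closure of the finitely supported functions\<close>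

lemma local_energy_tendsto:
  assumes "\<And>y. (\<lambda>k. \<psi> k y) \<longlonglongrightarrow> \<phi> y"
  shows "(\<lambda>k. L (\<psi> k) x) \<longlonglongrightarrow> L \<phi> x"
  unfolding local_energy_def using p
  by (intro tendsto_sum tendsto_powr' tendsto_intros assms) auto

lemma root_powr_tendsto_0:
  assumes "\<And>k. 0 \<le> e k" "e \<longlonglongrightarrow> 0" "\<And>k. \<bar>t k\<bar> powr p \<le> e k"
  shows "t \<longlonglongrightarrow> 0"
proof (rule tendsto_rabs_zero_cancel, rule tendsto_sandwich[of "\<lambda>_. 0"])
  have "\<bar>t k\<bar> \<le> e k powr (1 / p)" for k
  proof -
    have "\<bar>t k\<bar> = (\<bar>t k\<bar> powr p) powr (1 / p)" using p by (simp add: powr_powr)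
    also have "\<dots> \<le> e k powr (1 / p)" using p assms(3) by (intro powr_mono2) auto
    finally show ?thesis .
  qed
  then show "\<forall>\<^sub>F k in sequentially. \<bar>t k\<bar> \<le> e k powr (1 / p)" by simp
  have "(\<lambda>k. e k powr (1 / p)) \<longlonglongrightarrow> 0 powr (1 / p)"
    using p assms by (intro tendsto_powr') auto
  then show "(\<lambda>k. e k powr (1 / p)) \<longlonglongrightarrow> 0" using p by simp
qed auto

text \<open>The energy controls differences along edges, so convergence at one vertex spreads over
  the connected graph.\<close>

lemma energy_tendsto_0_pointwise:
  assumes F: "\<And>k. F k \<in> Dp adj p" and lim: "(\<lambda>k. E (F k)) \<longlonglongrightarrow> 0" and z: "(\<lambda>k. F k z) \<longlonglongrightarrow> 0"
  shows "(\<lambda>k. F k x) \<longlonglongrightarrow> 0"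
proof (rule connected_induct[where P = "\<lambda>x. (\<lambda>k. F k x) \<longlonglongrightarrow> 0", OF z])
  fix x y assume x: "(\<lambda>k. F k x) \<longlonglongrightarrow> 0" and xy: "adj x y"
  have "(\<lambda>k. F k y - F k x) \<longlonglongrightarrow> 0"
    by (rule root_powr_tendsto_0[OF energy_nonneg lim]) (rule edge_le_energy[OF F xy])
  from tendsto_add[OF this x] show "(\<lambda>k. F k y) \<longlonglongrightarrow> 0" by simp
qed

text \<open>The \<open>p\<close>-th power of the norm is the energy plus the \<open>p\<close>-th
  power of the value at \<open>z\<close>, so both tend to \<open>0\<close>; the value at
  \<open>z\<close> starts the pointwise convergence.\<close>

lemma Cc_closure_sequence:
  assumes g: "g \<in> Cc_closure adj p z"
  obtains G where "\<And>k. G k \<in> Cc" "(\<lambda>k. E (\<lambda>x. G k x - g x)) \<longlonglongrightarrow> 0" "\<And>x. (\<lambda>k. G k x) \<longlonglongrightarrow> g x"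
proof -
  have gD: "g \<in> Dp adj p" using g by (simp add: Cc_closure_def)
  have "\<exists>h\<in>Cc. Dp_norm adj p z (\<lambda>x. g x - h x) < inverse (real (Suc k))" for k
    using g by (auto simp: Cc_closure_def)
  then obtain G where G: "\<And>k. G k \<in> Cc" "\<And>k. Dp_norm adj p z (\<lambda>x. g x - G k x) < inverse (real (Suc k))"
    by metis
  define n where "n = (\<lambda>k. Dp_norm adj p z (\<lambda>x. g x - G k x))"
  have D: "(\<lambda>x. g x - G k x) \<in> Dp adj p" for k by (intro Dp_diff gD Cc_subset_Dp G)
  have n0: "0 \<le> n k" for k by (simp add: n_def Dp_norm_def)
  have "n \<longlonglongrightarrow> 0"
    by (rule tendsto_sandwich[OF _ _ tendsto_const LIMSEQ_inverse_real_of_nat])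
       (use n0 G(2) in \<open>auto simp: n_def intro!: always_eventually less_imp_le\<close>)
  then have "(\<lambda>k. n k powr p) \<longlonglongrightarrow> 0 powr p" using p n0 by (intro tendsto_powr') auto
  then have np: "(\<lambda>k. n k powr p) \<longlonglongrightarrow> 0" using p by simp
  have n_eq: "n k powr p = E (\<lambda>x. g x - G k x) + \<bar>g z - G k z\<bar> powr p" for k
    using p energy_nonneg by (simp add: n_def Dp_norm_def powr_powr)
  have "(\<lambda>k. E (\<lambda>x. g x - G k x)) \<longlonglongrightarrow> 0"
    by (rule tendsto_sandwich[OF _ _ tendsto_const np])
       (auto simp: n_eq intro!: always_eventually energy_nonneg)
  moreover have "(\<lambda>k. g z - G k z) \<longlonglongrightarrow> 0"
    by (rule root_powr_tendsto_0[OF _ np]) (auto simp: n_eq energy_nonneg)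
  ultimately have "(\<lambda>k. g x - G k x) \<longlonglongrightarrow> 0" for x
    by (rule energy_tendsto_0_pointwise[where F = "\<lambda>k x. g x - G k x", OF D])
  then have "(\<lambda>k. g x - (g x - G k x)) \<longlonglongrightarrow> g x - 0" for x by (intro tendsto_diff tendsto_const)
  then have "(\<lambda>k. G k x) \<longlonglongrightarrow> g x" for x by simp
  with \<open>(\<lambda>k. E (\<lambda>x. g x - G k x)) \<longlonglongrightarrow> 0\<close> G(1) show ?thesis
    by (intro that[of G]) (auto simp: energy_diff_commute[of g])
qed

text \<open>The constant depends on \<open>T\<close> but not on the family, so it is the same at all
  stages of an approximation.\<close>

lemma local_energy_sum_le:
  assumes "finite T"
  obtains C where "0 \<le> C" "\<And>f x. L (\<lambda>x. \<Sum>g\<in>T. f g x) x \<le> C * (\<Sum>g\<in>T. L (f g) x)"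
proof -
  have "\<exists>C\<ge>0. \<forall>f x. L (\<lambda>x. \<Sum>g\<in>T. f g x) x \<le> C * (\<Sum>g\<in>T. L (f g) x)"
    using assms
  proof (induction T)
    case empty
    show ?case by (intro exI[of _ 0]) (simp add: local_energy_eq_0)
  next
    case (insert t T)
    then obtain C where C: "0 \<le> C" "\<And>f x. L (\<lambda>x. \<Sum>g\<in>T. f g x) x \<le> C * (\<Sum>g\<in>T. L (f g) x)"
      by blast
    show ?case
    proof (intro exI conjI allI)
      show "0 \<le> 2 powr p * (1 + C)" using C by simp
      fix f x
      have s: "0 \<le> (\<Sum>g\<in>T. L (f g) x)" by (intro sum_nonneg local_energy_nonneg)
      have "L (\<lambda>x. \<Sum>g\<in>insert t T. f g x) x = L (\<lambda>x. f t x + (\<Sum>g\<in>T. f g x)) x"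
        using insert by simp
      also have "\<dots> \<le> 2 powr p * (L (f t) x + L (\<lambda>x. \<Sum>g\<in>T. f g x) x)"
        by (rule local_energy_add_le)
      also have "\<dots> \<le> 2 powr p * ((1 + C) * (L (f t) x + (\<Sum>g\<in>T. L (f g) x)))"
      proof (intro mult_left_mono)
        have "0 \<le> C * L (f t) x" using C(1) local_energy_nonneg by simp
        then show "L (f t) x + L (\<lambda>x. \<Sum>g\<in>T. f g x) x \<le> (1 + C) * (L (f t) x + (\<Sum>g\<in>T. L (f g) x))"
          using C(2)[of f x] s by (simp add: algebra_simps)
      qed simp
      finally show "L (\<lambda>x. \<Sum>g\<in>insert t T. f g x) x \<le> 2 powr p * (1 + C) * (\<Sum>g\<in>insert t T. L (f g) x)"
        using insert by (simp add: mult.assoc)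
    qed
  qed
  then show ?thesis using that by blast
qed

text \<open>Supplies the simultaneous approximation needed for compactness. If it failed, some
  \<open>\<bar>g\<bar>\<close> would be at least \<open>\<epsilon>\<close> at each point where
  \<open>w > 1 - \<epsilon>\<close>; cutoffs built from approximants of the \<open>g\<close> would
  then make the excess of \<open>w\<close> over \<open>s\<close> a limit of finitely supported
  functions, and the maximum principle would bound \<open>w\<close> by \<open>s < 1\<close>.\<close>

lemma harmonic_near_sup_and_null:
  assumes w: "w \<in> Dp adj p" and w01: "\<And>x. 0 \<le> w x" "\<And>x. w x \<le> 1"
    and w0: "\<And>x. x \<notin> U \<Longrightarrow> w x = 0" and z: "z \<notin> U"
    and harm: "\<And>x. x \<in> U \<Longrightarrow> Lap w x = 0"
    and sup: "\<And>s. s < 1 \<Longrightarrow> \<exists>x. s < w x"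
    and T: "finite T" "T \<subseteq> Cc_closure adj p v0" and \<epsilon>: "0 < \<epsilon>"
  shows "\<exists>x. 1 - \<epsilon> < w x \<and> (\<forall>g\<in>T. \<bar>g x\<bar> < \<epsilon>)"
proof (rule ccontr)
  assume "\<not> ?thesis"
  then have cover: "\<exists>g\<in>T. \<epsilon> \<le> \<bar>g x\<bar>" if "1 - \<epsilon> < w x" for x using that by force
  \<comment> \<open>The \<open>max\<close> keeps \<open>s\<close> nonnegative even for large
    \<open>\<epsilon>\<close>, so that \<open>v\<close> vanishes outside \<open>U\<close>.\<close>
  define s where "s = max 0 (1 - \<epsilon>)"
  define v where "v = (\<lambda>x. max 0 (w x - s))"
  have v01: "\<bar>v x\<bar> \<le> 1" for x using w01(2)[of x] by (auto simp: v_def s_def)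
  have TD: "g \<in> Dp adj p" if "g \<in> T" for g using T that by (auto simp: Cc_closure_def)
  have "\<forall>g\<in>T. \<exists>G. (\<forall>k. G k \<in> Cc) \<and> (\<lambda>k. E (\<lambda>x. G k x - g x)) \<longlonglongrightarrow> 0 \<and> (\<forall>x. (\<lambda>k. G k x) \<longlonglongrightarrow> g x)"
  proof
    fix g assume "g \<in> T"
    with T(2) have "g \<in> Cc_closure adj p v0" by auto
    from Cc_closure_sequence[OF this]
    show "\<exists>G. (\<forall>k. G k \<in> Cc) \<and> (\<lambda>k. E (\<lambda>x. G k x - g x)) \<longlonglongrightarrow> 0 \<and> (\<forall>x. (\<lambda>k. G k x) \<longlonglongrightarrow> g x)"
      by metis
  qed
  from bchoice[OF this] obtain G where G: "\<And>g k. g \<in> T \<Longrightarrow> G g k \<in> Cc"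
    "\<And>g. g \<in> T \<Longrightarrow> (\<lambda>k. E (\<lambda>x. G g k x - g x)) \<longlonglongrightarrow> 0"
    "\<And>g x. g \<in> T \<Longrightarrow> (\<lambda>k. G g k x) \<longlonglongrightarrow> g x" by blast
  \<comment> \<open>A cutoff with finite support, because the \<open>G g k\<close> have it; as
    \<open>k\<close> grows it tends to \<open>1\<close> wherever some \<open>\<bar>g\<bar>\<close>
    is at least \<open>\<epsilon>\<close>.\<close>
  define m where "m = (\<lambda>k x. min 1 ((\<Sum>g\<in>T. \<bar>G g k x\<bar>) / \<epsilon>))"
  define \<phi> where "\<phi> = (\<lambda>k x. v x * m k x)"
  have m01: "0 \<le> m k x" "m k x \<le> 1" for k x using \<epsilon> by (auto simp: m_def intro!: sum_nonneg divide_nonneg_nonneg)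
  have \<phi>Cc: "\<phi> k \<in> Cc" for k
  proof -
    have "{x. \<phi> k x \<noteq> 0} \<subseteq> (\<Union>g\<in>T. {x. G g k x \<noteq> 0})"
    proof (rule subsetI, rule ccontr)
      fix x assume x: "x \<in> {x. \<phi> k x \<noteq> 0}" and "x \<notin> (\<Union>g\<in>T. {x. G g k x \<noteq> 0})"
      then have "(\<Sum>g\<in>T. \<bar>G g k x\<bar>) = 0" by (intro sum.neutral) auto
      with x show False by (simp add: \<phi>_def m_def)
    qed
    moreover have "finite (\<Union>g\<in>T. {x. G g k x \<noteq> 0})" using T G(1) by (auto simp: Cc_def)
    ultimately show ?thesis unfolding Cc_def by (simp add: finite_subset)
  qed
  obtain C where C: "0 \<le> C" "\<And>f x. L (\<lambda>x. \<Sum>g\<in>T. f g x) x \<le> C * (\<Sum>g\<in>T. L (f g) x)"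
    using local_energy_sum_le[OF T(1)] by blast
  define c where "c = (1 / \<epsilon>) powr p * C * 2 powr p"
  have c0: "0 \<le> c" using C by (simp add: c_def)
  \<comment> \<open>A part independent of \<open>k\<close> and a part whose sum tends to
    \<open>0\<close>: the shape of majorant that dominated convergence asks for.\<close>
  have Lm: "L (m k) x \<le> c * (\<Sum>g\<in>T. L g x) + c * (\<Sum>g\<in>T. L (\<lambda>x. G g k x - g x) x)" for k x
  proof -
    have "\<bar>m k y - m k x\<bar> \<le> (1 / \<epsilon>) * \<bar>(\<Sum>g\<in>T. \<bar>G g k y\<bar>) - (\<Sum>g\<in>T. \<bar>G g k x\<bar>)\<bar>" for y
    proof -
      have "\<bar>m k y - m k x\<bar> \<le> \<bar>(\<Sum>g\<in>T. \<bar>G g k y\<bar>) / \<epsilon> - (\<Sum>g\<in>T. \<bar>G g k x\<bar>) / \<epsilon>\<bar>"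
        unfolding m_def by (auto simp: min_def)
      then show ?thesis using \<epsilon> by (simp add: diff_divide_distrib[symmetric])
    qed
    then have "L (m k) x \<le> (1 / \<epsilon>) powr p * L (\<lambda>x. \<Sum>g\<in>T. \<bar>G g k x\<bar>) x"
      using \<epsilon> by (intro local_energy_le_mult) auto
    also have "\<dots> \<le> (1 / \<epsilon>) powr p * (C * (\<Sum>g\<in>T. L (\<lambda>x. \<bar>G g k x\<bar>) x))"
      by (intro mult_left_mono C(2)) auto
    also have "\<dots> \<le> (1 / \<epsilon>) powr p * (C * (\<Sum>g\<in>T. 2 powr p * (L g x + L (\<lambda>x. G g k x - g x) x)))"
    proof (intro mult_left_mono sum_mono C(1))
      fix g
      have "L (\<lambda>x. \<bar>G g k x\<bar>) x \<le> 1 powr p * L (G g k) x"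
        by (rule local_energy_le_mult) auto
      also have "L (G g k) x \<le> 2 powr p * (L g x + L (\<lambda>x. G g k x - g x) x)"
        using local_energy_add_le[of g "\<lambda>x. G g k x - g x" x] by simp
      finally show "L (\<lambda>x. \<bar>G g k x\<bar>) x \<le> 2 powr p * (L g x + L (\<lambda>x. G g k x - g x) x)"
        by simp
    qed auto
    also have "\<dots> = c * (\<Sum>g\<in>T. L g x) + c * (\<Sum>g\<in>T. L (\<lambda>x. G g k x - g x) x)"
      by (simp only: c_def sum_distrib_left[symmetric] sum.distrib) (simp add: algebra_simps)
    finally show ?thesis .
  qed
  have v: "v \<in> Dp adj p" by (rule Dp_lipschitz(1)[OF w, of 1]) (auto simp: v_def)
  have "w x \<le> s" for x
  proof (rule harmonic_le_of_approx[OF w harm])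
    show "w z \<le> s" using w0[OF z] by (simp add: s_def)
    show "\<phi> k \<in> Cc" for k by (rule \<phi>Cc)
    show "\<phi> k x = 0" if "x \<notin> U" for k x using w0[OF that] by (simp add: \<phi>_def v_def s_def)
    have "(\<lambda>k. \<Sum>\<^sub>\<infinity>x. L (\<lambda>x. \<phi> k x - v x) x) \<longlonglongrightarrow> 0"
    proof (rule infsum_tendsto_zero_dominated)
      let ?a = "\<lambda>x. 2 powr p * (L v x + c * (\<Sum>g\<in>T. L g x))"
      let ?b = "\<lambda>k x. 2 powr p * (c * (\<Sum>g\<in>T. L (\<lambda>x. G g k x - g x) x))"
      have DG: "(\<lambda>x. G g k x - g x) \<in> Dp adj p" if "g \<in> T" for g k
        using that by (intro Dp_diff TD Cc_subset_Dp G)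
      show "?a summable_on UNIV" using v TD
        by (intro summable_on_cmult_right summable_on_add summable_on_sum T(1)) (auto simp: Dp_iff)
      show "?b k summable_on UNIV" for k using DG
        by (intro summable_on_cmult_right summable_on_add summable_on_sum T(1)) (auto simp: Dp_iff)
      show "0 \<le> ?a x" "0 \<le> ?b k x" "0 \<le> L (\<lambda>x. \<phi> k x - v x) x" for k x
        using c0 by (auto intro!: mult_nonneg_nonneg add_nonneg_nonneg sum_nonneg local_energy_nonneg)
      have "infsum (?b k) UNIV = 2 powr p * (c * (\<Sum>g\<in>T. E (\<lambda>x. G g k x - g x)))" for k
        using DG unfolding energy_def
        by (simp add: infsum_cmult_right' infsum_sum[OF T(1)] summable_on_sum[OF T(1)] Dp_iff)
      moreover have "(\<lambda>k. 2 powr p * (c * (\<Sum>g\<in>T. E (\<lambda>x. G g k x - g x)))) \<longlonglongrightarrow> 2 powr p * (c * (\<Sum>g\<in>T. 0))"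
        by (intro tendsto_intros G)
      ultimately show "(\<lambda>k. infsum (?b k) UNIV) \<longlonglongrightarrow> 0" by simp
      fix x
      show "L (\<lambda>x. \<phi> k x - v x) x \<le> ?a x + ?b k x" for k
      proof -
        have "L (\<lambda>x. \<phi> k x - v x) x \<le> 2 powr p * (L v x + L (m k) x)"
          unfolding local_energy_def sum.distrib[symmetric] sum_distrib_left
        proof (rule sum_mono)
          fix y
          \<comment> \<open>Discrete product rule for \<open>v\<close> times
            \<open>m k - 1\<close>.\<close>
          have "\<phi> k y - v y - (\<phi> k x - v x) = (m k y - 1) * (v y - v x) + v x * (m k y - m k x)"
            by (simp add: \<phi>_def algebra_simps)
          also have "\<bar>\<dots>\<bar> powr p \<le> 2 powr p * (\<bar>(m k y - 1) * (v y - v x)\<bar> powr p + \<bar>v x * (m k y - m k x)\<bar> powr p)"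
            by (rule abs_powr_add_le[OF p])
          also have "\<dots> \<le> 2 powr p * (\<bar>v y - v x\<bar> powr p + \<bar>m k y - m k x\<bar> powr p)"
            using p v01[of x] m01[of k y]
            by (intro mult_left_mono add_mono powr_mono2) (auto simp: abs_mult intro!: mult_left_le_one_le)
          finally show "\<bar>\<phi> k y - v y - (\<phi> k x - v x)\<bar> powr p \<le> 2 powr p * (\<bar>v y - v x\<bar> powr p + \<bar>m k y - m k x\<bar> powr p)" .
        qed
        also have "\<dots> \<le> 2 powr p * (L v x + (c * (\<Sum>g\<in>T. L g x) + c * (\<Sum>g\<in>T. L (\<lambda>x. G g k x - g x) x)))"
          by (intro mult_left_mono add_left_mono Lm) auto
        finally show ?thesis by (simp add: algebra_simps)
      qed
      have "(\<lambda>k. L (\<lambda>x. \<phi> k x - v x) x) \<longlonglongrightarrow> L (\<lambda>_. 0) x"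
      proof (rule local_energy_tendsto)
        fix y
        show "(\<lambda>k. \<phi> k y - v y) \<longlonglongrightarrow> 0"
        \<comment> \<open>Where \<open>w y \<le> s\<close> both functions are \<open>0\<close>;
          elsewhere the cover makes the limit of the cutoff equal to \<open>1\<close>.\<close>
        proof (cases "s < w y")
          case False
          then show ?thesis by (simp add: \<phi>_def v_def)
        next
          case True
          then obtain g where g: "g \<in> T" "\<epsilon> \<le> \<bar>g y\<bar>" using cover[of y] by (auto simp: s_def)
          have "\<bar>g y\<bar> \<le> (\<Sum>g\<in>T. \<bar>g y\<bar>)" using g T
            by (intro member_le_sum[of g T "\<lambda>g. \<bar>g y\<bar>"]) auto
          then have 1: "min 1 ((\<Sum>g\<in>T. \<bar>g y\<bar>) / \<epsilon>) = 1" using g \<epsilon> by (simp add: field_simps)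
          have "(\<lambda>k. m k y) \<longlonglongrightarrow> min 1 ((\<Sum>g\<in>T. \<bar>g y\<bar>) / \<epsilon>)" unfolding m_def
            using \<epsilon> by (intro tendsto_intros G) auto
          then have "(\<lambda>k. v y * m k y - v y) \<longlonglongrightarrow> v y * 1 - v y" unfolding 1 by (intro tendsto_intros)
          then show ?thesis by (simp add: \<phi>_def)
        qed
      qed
      then show "(\<lambda>k. L (\<lambda>x. \<phi> k x - v x) x) \<longlonglongrightarrow> 0" by (simp add: local_energy_eq_0)
    qed
    then show "(\<lambda>k. E (\<lambda>x. \<phi> k x - max 0 (w x - s))) \<longlonglongrightarrow> 0"
      by (simp add: energy_def v_def)
  qed
  moreover have "s < 1" using \<epsilon> by (simp add: s_def)
  ultimately show False using sup[of s] by (meson not_less)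
qed

section \<open>Characters\<close>

abbreviation "B \<equiv> BDp adj p"

lemma BDp_iff: "f \<in> B \<longleftrightarrow> f \<in> Dp adj p \<and> (\<exists>M. \<forall>x. \<bar>f x\<bar> \<le> M)"
  by (auto simp: BDp_def bounded_iff)

lemma BDp_const: "(\<lambda>_. c) \<in> B"
  using Dp_const by (auto simp: BDp_iff)

lemma BDp_cmult: "f \<in> B \<Longrightarrow> (\<lambda>x. c * f x) \<in> B"
proof -
  assume "f \<in> B"
  then obtain M where "f \<in> Dp adj p" "\<And>x. \<bar>f x\<bar> \<le> M" by (auto simp: BDp_iff)
  then show ?thesis unfolding BDp_iff
    by (auto simp: abs_mult intro!: Dp_cmult exI[of _ "\<bar>c\<bar> * M"] mult_left_mono)
qed

lemma BDp_add: "f \<in> B \<Longrightarrow> g \<in> B \<Longrightarrow> (\<lambda>x. f x + g x) \<in> B"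
proof -
  assume "f \<in> B" "g \<in> B"
  then obtain M N where "f \<in> Dp adj p" "\<And>x. \<bar>f x\<bar> \<le> M" "g \<in> Dp adj p" "\<And>x. \<bar>g x\<bar> \<le> N"
    by (auto simp: BDp_iff)
  then show ?thesis unfolding BDp_iff
    by (auto intro!: Dp_add exI[of _ "M + N"] order_trans[OF abs_triangle_ineq] add_mono)
qed

lemma BDp_diff: "f \<in> B \<Longrightarrow> g \<in> B \<Longrightarrow> (\<lambda>x. f x - g x) \<in> B"
  using BDp_add[of f "\<lambda>x. -1 * g x"] BDp_cmult[of g "-1"] by simp

text \<open>Discrete product rule, with bounds of the factors as coefficients.\<close>

lemma BDp_mult: "f \<in> B \<Longrightarrow> g \<in> B \<Longrightarrow> (\<lambda>x. f x * g x) \<in> B"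
proof -
  assume fg: "f \<in> B" "g \<in> B"
  then obtain M N where M: "\<And>x. \<bar>f x\<bar> \<le> M" and N: "\<And>x. \<bar>g x\<bar> \<le> N"
    by (auto simp: BDp_iff)
  have M0: "0 \<le> M" and N0: "0 \<le> N" using M[of undefined] N[of undefined] by auto
  have le: "L (\<lambda>x. f x * g x) x \<le> 2 powr p * (M powr p * L g x + N powr p * L f x)" for x
    unfolding local_energy_def sum_distrib_left sum.distrib[symmetric]
  proof (rule sum_mono)
    fix y
    have "f y * g y - f x * g x = f y * (g y - g x) + g x * (f y - f x)" by (simp add: algebra_simps)
    also have "\<bar>\<dots>\<bar> powr p \<le> 2 powr p * (\<bar>f y * (g y - g x)\<bar> powr p + \<bar>g x * (f y - f x)\<bar> powr p)"
      by (rule abs_powr_add_le[OF p])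
    also have "\<dots> \<le> 2 powr p * (M powr p * \<bar>g y - g x\<bar> powr p + N powr p * \<bar>f y - f x\<bar> powr p)"
      unfolding abs_mult powr_mult using p M N
      by (intro mult_left_mono add_mono mult_right_mono powr_mono2) auto
    finally show "\<bar>f y * g y - f x * g x\<bar> powr p \<le>
        2 powr p * (M powr p * \<bar>g y - g x\<bar> powr p + N powr p * \<bar>f y - f x\<bar> powr p)" .
  qed
  have "(\<lambda>x. f x * g x) \<in> Dp adj p"
    by (rule Dp_dominated(1)[OF le])
       (use fg in \<open>auto simp: BDp_iff Dp_iff intro!: summable_on_add summable_on_cmult_right\<close>)
  then show ?thesis using M N M0 unfolding BDp_iff
    by (auto simp: abs_mult intro!: exI[of _ "M * N"] mult_mono)
qed

text \<open>Closes the algebra under Lipschitz functions, which later provides the hat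
  functions.\<close>

lemma BDp_comp:
  assumes f: "f \<in> B" and K: "0 \<le> K" "\<And>a b. \<bar>F a - F b\<bar> \<le> K * \<bar>a - b\<bar>"
  shows "(\<lambda>x. F (f x)) \<in> B"
proof -
  obtain M where fD: "f \<in> Dp adj p" and M: "\<And>x. \<bar>f x\<bar> \<le> M" using f by (auto simp: BDp_iff)
  have "\<bar>F (f x)\<bar> \<le> \<bar>F 0\<bar> + K * M" for x
  proof -
    have "K * \<bar>f x\<bar> \<le> K * M" using K(1) M by (rule mult_left_mono[rotated])
    then show ?thesis using K(2)[of "f x" 0] by simp
  qed
  moreover have "(\<lambda>x. F (f x)) \<in> Dp adj p" by (rule Dp_lipschitz(1)[OF fD K(1) K(2)])
  ultimately show ?thesis by (auto simp: BDp_iff)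
qed

text \<open>On arguments that are at least \<open>c\<close>, the reciprocal is Lipschitz with
  constant \<open>1 / c\<^sup>2\<close>.\<close>

lemma BDp_inverse:
  assumes f: "f \<in> B" and c: "0 < c" "\<And>x. c \<le> f x"
  shows "(\<lambda>x. 1 / f x) \<in> B"
proof -
  have pos: "0 < f x" for x using c(1) c(2)[of x] by linarith
  have "\<bar>1 / f y - 1 / f x\<bar> \<le> 1 / c\<^sup>2 * \<bar>f y - f x\<bar>" for x y
  proof -
    have "1 / f y - 1 / f x = - (f y - f x) / (f y * f x)"
      using pos[of x] pos[of y] by (simp add: field_simps)
    then have "\<bar>1 / f y - 1 / f x\<bar> = \<bar>f y - f x\<bar> / (f y * f x)"
      using pos[of x] pos[of y] by (simp add: abs_mult)
    also have "\<dots> \<le> \<bar>f y - f x\<bar> / (c * c)"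
      using c pos by (intro divide_left_mono mult_mono mult_pos_pos) (auto intro: less_imp_le)
    finally show ?thesis by (simp add: power2_eq_square)
  qed
  then have "(\<lambda>x. 1 / f x) \<in> Dp adj p"
    by (intro Dp_lipschitz(1)[of f "1 / c\<^sup>2" "\<lambda>x. 1 / f x"]) (use f in \<open>auto simp: BDp_iff\<close>)
  moreover have "\<bar>1 / f x\<bar> \<le> 1 / c" for x using c pos[of x] by (simp add: frac_le)
  ultimately show ?thesis by (auto simp: BDp_iff)
qed

section \<open>Values of characters\<close>

lemma Sp_add: "\<xi> \<in> Sp adj p \<Longrightarrow> f \<in> B \<Longrightarrow> g \<in> B \<Longrightarrow> \<xi> (\<lambda>x. f x + g x) = \<xi> f + \<xi> g"
  and Sp_mult: "\<xi> \<in> Sp adj p \<Longrightarrow> f \<in> B \<Longrightarrow> g \<in> B \<Longrightarrow> \<xi> (\<lambda>x. f x * g x) = \<xi> f * \<xi> g"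
  and Sp_cmult: "\<xi> \<in> Sp adj p \<Longrightarrow> f \<in> B \<Longrightarrow> \<xi> (\<lambda>x. c * f x) = complex_of_real c * \<xi> f"
  by (auto simp: Sp_def)

lemma Sp_one: assumes "\<xi> \<in> Sp adj p" shows "\<xi> (\<lambda>_. 1) = 1"
proof -
  obtain f where f: "f \<in> B" "\<xi> f \<noteq> 0" using assms by (auto simp: Sp_def)
  have "\<xi> f = \<xi> (\<lambda>_. 1) * \<xi> f" using Sp_mult[OF assms BDp_const[of 1] f(1)] by simp
  with f show ?thesis by simp
qed

lemma Sp_const: "\<xi> \<in> Sp adj p \<Longrightarrow> \<xi> (\<lambda>_. c) = complex_of_real c"
  using Sp_cmult[of \<xi> "\<lambda>_. 1" c] Sp_one BDp_const by simp

lemma Sp_diff: "\<xi> \<in> Sp adj p \<Longrightarrow> f \<in> B \<Longrightarrow> g \<in> B \<Longrightarrow> \<xi> (\<lambda>x. f x - g x) = \<xi> f - \<xi> g"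
  using Sp_add[of \<xi> f "\<lambda>x. -1 * g x"] Sp_cmult[of \<xi> g "-1"] BDp_cmult[of g "-1"] by simp

text \<open>
  Otherwise the sum of the squared distances would be bounded away from \<open>0\<close>, hence invertible
  in the algebra, although every character maps it to \<open>0\<close>.
\<close>

lemma Sp_approx:
  assumes \<xi>: "\<xi> \<in> Sp adj p" and f: "f \<in> B" and g: "g \<in> B" and \<delta>: "0 < \<delta>"
  shows "\<exists>x. cmod (complex_of_real (f x) - \<xi> f) < \<delta> \<and> cmod (complex_of_real (g x) - \<xi> g) < \<delta>"
proof (rule ccontr)
  assume neg: "\<not> ?thesis"
  define a b c d where "a = Re (\<xi> f)" and "b = Im (\<xi> f)" and "c = Re (\<xi> g)" and "d = Im (\<xi> g)"
  have \<xi>f: "\<xi> f = Complex a b" and \<xi>g: "\<xi> g = Complex c d" by (simp_all add: a_def b_def c_def d_def)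
  define f' where "f' = (\<lambda>x. f x - a)"
  define g' where "g' = (\<lambda>x. g x - c)"
  \<comment> \<open>As \<open>f\<close> and \<open>g\<close> are real-valued, this is the sum of the
    squared distances to \<open>\<xi> f\<close> and \<open>\<xi> g\<close>. Subtracting only the
    real parts keeps the construction inside the real algebra.\<close>
  define q where "q = (\<lambda>x. (f' x * f' x + g' x * g' x) + (b\<^sup>2 + d\<^sup>2))"
  have f': "f' \<in> B" "\<xi> f' = Complex 0 b"
    using BDp_diff[OF f BDp_const] Sp_diff[OF \<xi> f BDp_const] Sp_const[OF \<xi>]
    by (auto simp: f'_def \<xi>f complex_eq_iff)
  have g': "g' \<in> B" "\<xi> g' = Complex 0 d"
    using BDp_diff[OF g BDp_const] Sp_diff[OF \<xi> g BDp_const] Sp_const[OF \<xi>]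
    by (auto simp: g'_def \<xi>g complex_eq_iff)
  have q: "q \<in> B" unfolding q_def by (intro BDp_add BDp_mult BDp_const f' g')
  \<comment> \<open>The values at \<open>f'\<close> and \<open>g'\<close> are purely imaginary, so
    their squares cancel \<open>b\<^sup>2 + d\<^sup>2\<close>.\<close>
  have "\<xi> q = (\<xi> f' * \<xi> f' + \<xi> g' * \<xi> g') + complex_of_real (b\<^sup>2 + d\<^sup>2)"
    unfolding q_def using f' g' by (simp only: Sp_add[OF \<xi>] Sp_mult[OF \<xi>] Sp_const[OF \<xi>] BDp_add BDp_mult BDp_const)
  then have \<xi>q: "\<xi> q = 0" by (simp add: f' g' complex_eq_iff power2_eq_square)
  have "\<delta>\<^sup>2 \<le> q x" for x
  proof -
    have sq: "(cmod (complex_of_real t - Complex r s))\<^sup>2 = (t - r) * (t - r) + s\<^sup>2" for t r s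
      by (simp add: cmod_def power2_eq_square)
    have nn: "0 \<le> (t - r) * (t - r) + s\<^sup>2" for t r s :: real by simp
    from neg consider "\<delta> \<le> cmod (complex_of_real (f x) - \<xi> f)" | "\<delta> \<le> cmod (complex_of_real (g x) - \<xi> g)"
      by (meson not_less)
    then show ?thesis
    proof cases
      case 1
      then have "\<delta>\<^sup>2 \<le> (cmod (complex_of_real (f x) - \<xi> f))\<^sup>2" using \<delta> by (intro power_mono) auto
      then show ?thesis using nn[of "g x" c d] unfolding \<xi>f sq q_def f'_def g'_def by linarith
    next
      case 2
      then have "\<delta>\<^sup>2 \<le> (cmod (complex_of_real (g x) - \<xi> g))\<^sup>2" using \<delta> by (intro power_mono) auto
      then show ?thesis using nn[of "f x" a b] unfolding \<xi>g sq q_def f'_def g'_def by linarith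
    qed
  qed
  note q_ge = this
  have inv: "(\<lambda>x. 1 / q x) \<in> B" by (rule BDp_inverse[OF q _ q_ge]) (use \<delta> in simp)
  have q0: "q x \<noteq> 0" for x using q_ge[of x] \<delta> by (metis not_less zero_less_power)
  have "\<xi> (\<lambda>x. q x * (1 / q x)) = 0" using Sp_mult[OF \<xi> q inv] \<xi>q by simp
  moreover have "(\<lambda>x. q x * (1 / q x)) = (\<lambda>_. 1)" using q0 by simp
  ultimately show False using Sp_one[OF \<xi>] by simp
qed

text \<open>Every real number is at least \<open>\<bar>Im (\<xi> f)\<bar>\<close> away from
  \<open>\<xi> f\<close>, so approximation by values of \<open>f\<close> leaves no room for an
  imaginary part.\<close>

lemma Sp_real:
  assumes "\<xi> \<in> Sp adj p" "f \<in> B"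
  shows "\<xi> f = complex_of_real (Re (\<xi> f))"
proof (rule ccontr)
  assume "\<not> ?thesis"
  then have "0 < \<bar>Im (\<xi> f)\<bar>" by (auto simp: complex_eq_iff)
  from Sp_approx[OF assms assms(2) this] obtain x
    where "cmod (complex_of_real (f x) - \<xi> f) < \<bar>Im (\<xi> f)\<bar>" by auto
  moreover have "\<bar>Im (\<xi> f)\<bar> \<le> cmod (complex_of_real (f x) - \<xi> f)"
    using abs_Im_le_cmod[of "complex_of_real (f x) - \<xi> f"] by simp
  ultimately show False by simp
qed

text \<open>One vertex approximates the values of \<open>\<xi>\<close> at \<open>f\<close> and at
  the composition simultaneously, and the Lipschitz bound compares the two.\<close>

lemma Sp_comp:
  assumes \<xi>: "\<xi> \<in> Sp adj p" and f: "f \<in> B"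
    and K: "0 \<le> K" "\<And>a b. \<bar>F a - F b\<bar> \<le> K * \<bar>a - b\<bar>"
  shows "\<xi> (\<lambda>x. F (f x)) = complex_of_real (F (Re (\<xi> f)))"
proof -
  define a where "a = Re (\<xi> f)"
  define b where "b = Re (\<xi> (\<lambda>x. F (f x)))"
  have Ff: "(\<lambda>x. F (f x)) \<in> B" by (rule BDp_comp[OF f K])
  have a: "\<xi> f = complex_of_real a" unfolding a_def by (rule Sp_real[OF \<xi> f])
  have b: "\<xi> (\<lambda>x. F (f x)) = complex_of_real b" unfolding b_def by (rule Sp_real[OF \<xi> Ff])
  have "\<bar>b - F a\<bar> \<le> 0 + e" if "0 < e" for e
  proof -
    \<comment> \<open>Chosen so that \<open>\<delta> + K * \<delta> = e\<close>.\<close>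
    define \<delta> where "\<delta> = e / (1 + K)"
    have \<delta>: "0 < \<delta>" using that K by (simp add: \<delta>_def)
    from Sp_approx[OF \<xi> f Ff this] obtain x where x: "\<bar>f x - a\<bar> < \<delta>" "\<bar>F (f x) - b\<bar> < \<delta>"
      unfolding a b of_real_diff[symmetric] norm_of_real by auto
    have "K * \<bar>f x - a\<bar> \<le> K * \<delta>" using x K by (intro mult_left_mono) auto
    then have "\<bar>b - F a\<bar> \<le> \<delta> + K * \<delta>" using K(2)[of "f x" a] x by linarith
    also have "\<dots> = \<delta> * (1 + K)" by (simp add: algebra_simps)
    also have "\<dots> = e" using K(1) by (simp add: \<delta>_def)
    finally show ?thesis by simp
  qed
  then have "b = F a" using field_le_epsilon[of "\<bar>b - F a\<bar>" 0] by simp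
  with b show ?thesis by (simp add: a_def)
qed

text \<open>As in Lagrange interpolation, a product over the characters to be annihilated; each
  factor is affine in a function that separates one of them from \<open>\<xi>\<close>.\<close>

lemma Sp_separate_point:
  assumes \<xi>: "\<xi> \<in> Sp adj p" and X: "finite X" "X \<subseteq> Sp adj p" "\<xi> \<notin> X"
  shows "\<exists>g\<in>B. \<xi> g = 1 \<and> (\<forall>\<psi>\<in>X. \<psi> g = 0)"
  using X
proof (induction X)
  case empty
  show ?case using BDp_const Sp_one[OF \<xi>] by (intro bexI[of _ "\<lambda>_. 1"]) auto
next
  case (insert \<psi> X)
  then obtain g where g: "g \<in> B" "\<xi> g = 1" "\<And>\<psi>. \<psi> \<in> X \<Longrightarrow> \<psi> g = 0" by auto
  have \<psi>: "\<psi> \<in> Sp adj p" "\<xi> \<noteq> \<psi>" using insert by auto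
  \<comment> \<open>Characters are extensional, so distinct ones differ at some member of the
    algebra.\<close>
  obtain f where f: "f \<in> B" "\<xi> f \<noteq> \<psi> f"
    using \<xi> \<psi> extensionalityI[of \<xi> B \<psi>] by (auto simp: Sp_def)
  define a b where "a = Re (\<xi> f)" and "b = Re (\<psi> f)"
  have ab: "\<xi> f = complex_of_real a" "\<psi> f = complex_of_real b"
    using Sp_real \<xi> \<psi>(1) f(1) by (auto simp: a_def b_def)
  with f have "a \<noteq> b" by auto
  define h where "h = (\<lambda>x. 1 / (a - b) * (f x - b))"
  have h: "h \<in> B" unfolding h_def by (intro BDp_cmult BDp_diff f BDp_const)
  have val: "\<phi> h = complex_of_real (1 / (a - b)) * (\<phi> f - complex_of_real b)" if "\<phi> \<in> Sp adj p" for \<phi>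
    unfolding h_def using Sp_cmult[OF that BDp_diff[OF f(1) BDp_const], of "1 / (a - b)" b]
      Sp_diff[OF that f(1) BDp_const[of b]] Sp_const[OF that, of b] by simp
  have "\<xi> h = 1" "\<psi> h = 0" using val[OF \<xi>] val[OF \<psi>(1)] ab \<open>a \<noteq> b\<close>
    by (auto simp: of_real_diff[symmetric] simp del: of_real_diff)
  then show ?case using g h \<xi> \<psi>(1) insert.prems
    by (intro bexI[of _ "\<lambda>x. g x * h x"]) (auto simp: Sp_mult BDp_mult subset_iff)
qed

text \<open>As in Newton interpolation, the value at the new character is corrected by a multiple of
  a function that vanishes at the earlier ones.\<close>

lemma Sp_interpolate:
  assumes "finite X" "X \<subseteq> Sp adj p"
  shows "\<exists>G\<in>B. \<forall>\<xi>\<in>X. \<xi> G = complex_of_real (c \<xi>)"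
  using assms
proof (induction X)
  case empty
  show ?case using BDp_const by auto
next
  case (insert \<xi> X)
  then obtain G where G: "G \<in> B" "\<And>\<psi>. \<psi> \<in> X \<Longrightarrow> \<psi> G = complex_of_real (c \<psi>)" by auto
  obtain g where g: "g \<in> B" "\<xi> g = 1" "\<And>\<psi>. \<psi> \<in> X \<Longrightarrow> \<psi> g = 0"
    using Sp_separate_point[of \<xi> X] insert by auto
  define t where "t = c \<xi> - Re (\<xi> G)"
  have t: "complex_of_real t = c \<xi> - \<xi> G" using Sp_real[of \<xi> G] G insert.prems by (simp add: t_def)
  have val: "\<phi> (\<lambda>x. G x + t * g x) = \<phi> G + complex_of_real t * \<phi> g" if "\<phi> \<in> Sp adj p" for \<phi>
    using Sp_add[OF that G(1) BDp_cmult[OF g(1)], of t] Sp_cmult[OF that g(1), of t] by simp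
  show ?case
  proof (intro bexI[of _ "\<lambda>x. G x + t * g x"] ballI)
    show "(\<lambda>x. G x + t * g x) \<in> B" by (intro BDp_add BDp_cmult G g)
    fix \<phi> assume \<phi>: "\<phi> \<in> insert \<xi> X"
    then have "\<phi> \<in> Sp adj p" using insert.prems by auto
    from \<phi> show "\<phi> (\<lambda>x. G x + t * g x) = complex_of_real (c \<phi>)"
      unfolding val[OF \<open>\<phi> \<in> Sp adj p\<close>] using G g t by auto
  qed
qed

text \<open>
  A cluster point of the point evaluations, which exists by Tychonoff's theorem.
\<close>

lemma Sp_exists_vanishing:
  assumes N: "N \<subseteq> B"
    and approx: "\<And>T \<epsilon>. finite T \<Longrightarrow> T \<subseteq> N \<Longrightarrow> 0 < \<epsilon> \<Longrightarrow> \<exists>x. \<forall>g\<in>T. \<bar>g x\<bar> < \<epsilon>"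
  shows "\<exists>\<xi>\<in>Sp adj p. \<forall>g\<in>N. \<xi> g = 0"
proof -
  have "\<forall>f. \<exists>M. f \<in> B \<longrightarrow> (\<forall>x. \<bar>f x\<bar> \<le> M)" by (auto simp: BDp_iff)
  then obtain M where M: "\<And>f x. f \<in> B \<Longrightarrow> \<bar>f x\<bar> \<le> M f" by metis
  define ev where "ev = (\<lambda>x f. if f \<in> B then f x else (0::real))"
  \<comment> \<open>Coordinates outside the algebra are pinned to \<open>0\<close>, so that every
    factor is compact.\<close>
  define K where "K = PiE UNIV (\<lambda>f. if f \<in> B then {- M f..M f} else {0::real})"
  \<comment> \<open>Closed conditions for a unital homomorphism; the value at \<open>1\<close> keeps
    a cluster point from being zero.\<close>
  define H where "H = {\<phi>. \<phi> (\<lambda>_. 1) = (1::real)} \<inter> (\<Inter>f\<in>B. \<Inter>g\<in>B. {\<phi>. \<phi> (\<lambda>x. f x + g x) = \<phi> f + \<phi> g})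
    \<inter> (\<Inter>f\<in>B. \<Inter>g\<in>B. {\<phi>. \<phi> (\<lambda>x. f x * g x) = \<phi> f * \<phi> g})
    \<inter> (\<Inter>c. \<Inter>f\<in>B. {\<phi>. \<phi> (\<lambda>x. c * f x) = c * \<phi> f})"
  have "compactin (product_topology (\<lambda>i. euclidean) UNIV) K"
    unfolding K_def compactin_PiE by (auto simp: compactin_euclidean_iff)
  then have "compact K" by (simp add: euclidean_product_topology compactin_euclidean_iff)
  moreover have "closed H" unfolding H_def
    by (intro closed_Int closed_INT ballI closed_Collect_eq continuous_intros continuous_on_product_coordinates)
  ultimately have KH: "compact (K \<inter> H)" by (rule compact_Int_closed)
  have evKH: "ev x \<in> K \<inter> H" for x
  proof -
    have "f x \<le> M f" "- f x \<le> M f" if "f \<in> B" for f using M[OF that, of x] by auto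
    then show ?thesis
      by (force simp: ev_def K_def H_def BDp_add BDp_mult BDp_cmult BDp_const)
  qed
  \<comment> \<open>Evaluations are only small on \<open>N\<close>, so vanishing is expressed as a
    bound for every positive tolerance.\<close>
  have "(K \<inter> H) \<inter> (\<Inter>i\<in>N \<times> {0<..}. {\<phi>. \<bar>\<phi> (fst i)\<bar> \<le> snd i}) \<noteq> {}"
  proof (rule compact_imp_fip_image[OF KH])
    show "closed {\<phi>. \<bar>\<phi> (fst i)\<bar> \<le> snd i}" for i :: "('v \<Rightarrow> real) \<times> real"
      by (intro closed_Collect_le continuous_intros continuous_on_product_coordinates)
  next
    fix I' assume I': "finite I'" "I' \<subseteq> N \<times> {0::real<..}"
    \<comment> \<open>The inserted \<open>1\<close> covers an empty set of conditions.\<close>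
    define \<epsilon> where "\<epsilon> = Min (insert 1 (snd ` I'))"
    have \<epsilon>: "0 < \<epsilon>" "\<And>i. i \<in> I' \<Longrightarrow> \<epsilon> \<le> snd i" using I' by (auto simp: \<epsilon>_def)
    have sub: "fst ` I' \<subseteq> N" using I' by auto
    from approx[OF finite_imageI[OF I'(1)] this \<epsilon>(1)]
    obtain x where x: "\<And>i. i \<in> I' \<Longrightarrow> \<bar>fst i x\<bar> < \<epsilon>" by auto
    have "\<bar>ev x (fst i)\<bar> \<le> snd i" if "i \<in> I'" for i
      using x[OF that] \<epsilon>(2)[OF that] \<epsilon>(1) by (auto simp: ev_def)
    with evKH[of x] show "(K \<inter> H) \<inter> (\<Inter>i\<in>I'. {\<phi>. \<bar>\<phi> (fst i)\<bar> \<le> snd i}) \<noteq> {}" by auto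
  qed
  then obtain \<phi> where \<phi>: "\<phi> \<in> H" and lim: "\<phi> \<in> (\<Inter>i\<in>N \<times> {0<..}. {\<phi>. \<bar>\<phi> (fst i)\<bar> \<le> snd i})"
    by blast
  have \<phi>0: "\<phi> g = 0" if "g \<in> N" for g
    using that lim field_le_epsilon[of "\<bar>\<phi> g\<bar>" 0] by simp
  define \<xi> where "\<xi> = (\<lambda>f\<in>B. complex_of_real (\<phi> f))"
  have "\<xi> \<in> Sp adj p"
  proof -
    have "\<exists>f\<in>B. \<xi> f \<noteq> 0" using \<phi> BDp_const
      by (intro bexI[of _ "\<lambda>_. 1"]) (auto simp: \<xi>_def H_def)
    then show ?thesis using \<phi>
      unfolding Sp_def \<xi>_def by (auto simp: H_def BDp_add BDp_mult BDp_cmult)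
  qed
  moreover have "\<forall>g\<in>N. \<xi> g = 0" using N \<phi>0 by (auto simp: \<xi>_def)
  ultimately show ?thesis by blast
qed

section \<open>From massive sets to characters\<close>

text \<open>Since \<open>u\<close> vanishes on the outer boundary, cutting it off outside
  \<open>U\<close> leaves it unchanged on \<open>U\<close> and on all neighbours of
  \<open>U\<close>. The Laplacian on \<open>U\<close> stays \<open>0\<close> and no edge difference
  grows.\<close>

lemma massive_function:
  assumes "Dp_massive adj p U"
  obtains w z where "w \<in> B" "\<And>x. 0 \<le> w x" "\<And>x. w x \<le> 1" "\<And>x. x \<notin> U \<Longrightarrow> w x = 0" "z \<notin> U"
    "\<And>x. x \<in> U \<Longrightarrow> Lap w x = 0" "\<And>s. s < 1 \<Longrightarrow> \<exists>x. s < w x"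
proof -
  from assms obtain u where U: "infinite U" "outer_boundary adj U \<noteq> {}" and u: "u \<in> B"
    and u0: "\<And>x. 0 \<le> u x" and harm: "\<And>x. x \<in> U \<Longrightarrow> Lap u x = 0"
    and bd: "\<And>x. x \<in> outer_boundary adj U \<Longrightarrow> u x = 0" and sup: "(SUP x\<in>U. u x) = 1"
    by (auto simp: Dp_massive_def)
  define w where "w = (\<lambda>x. if x \<in> U then u x else 0)"
  from u obtain M where uD: "u \<in> Dp adj p" and M: "\<And>x. \<bar>u x\<bar> \<le> M" by (auto simp: BDp_iff)
  have bdd: "bdd_above (u ` U)" using M by (intro bdd_aboveI2[of _ _ M]) (auto simp: abs_le_iff)
  have u1: "u x \<le> 1" if "x \<in> U" for x using cSUP_upper[OF that bdd] sup by simp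
  have wu: "w y = u y" if "x \<in> U" "adj x y" for x y
  proof (cases "y \<in> U")
    case False
    moreover have "x \<in> nbrs adj y \<inter> U" using that adj_sym by simp
    ultimately have "y \<in> outer_boundary adj U" by (auto simp: outer_boundary_def)
    then show ?thesis using bd False by (simp add: w_def)
  qed (simp add: w_def)
  have "\<bar>w y - w x\<bar> \<le> 1 * \<bar>u y - u x\<bar>" if "adj x y" for x y
    using wu[OF _ that] wu[OF _ adj_sym[OF that]] by (cases "x \<in> U"; cases "y \<in> U") (auto simp: w_def)
  then have "w \<in> Dp adj p" by (intro Dp_lipschitz(1)[OF uD, of 1]) auto
  moreover have "\<bar>w x\<bar> \<le> 1" for x using u0 u1 by (simp add: w_def)
  ultimately have "w \<in> B" by (auto simp: BDp_iff)
  moreover obtain z where "z \<notin> U" using U(2) by (auto simp: outer_boundary_def)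
  moreover have "Lap w x = 0" if "x \<in> U" for x
  proof -
    have "Lap w x = Lap u x" unfolding p_laplacian_def
      using wu[OF that] that by (intro sum.cong) (auto simp: w_def)
    then show ?thesis using harm[OF that] by simp
  qed
  moreover have "\<exists>x. s < w x" if "s < 1" for s
  proof -
    have "U \<noteq> {}" using U(1) by auto
    from less_cSUP_iff[OF this bdd] that sup obtain x where "x \<in> U" "s < u x" by auto
    then show ?thesis by (intro exI[of _ x]) (simp add: w_def)
  qed
  ultimately show ?thesis using u0 u1 by (intro that[of w z]) (auto simp: w_def)
qed

lemma B_Cc_closure_delta: "(\<lambda>y. if y = x then 1 else 0) \<in> B_Cc_closure adj p z"
proof -
  let ?d = "\<lambda>y. if y = x then 1 else (0::real)"
  have "Dp_norm adj p z (\<lambda>y. ?d y - ?d y) = 0"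
    using p by (simp add: Dp_norm_def energy_def local_energy_eq_0)
  then have "?d \<in> Cc_closure adj p z"
    using Cc_delta[of x 1] Cc_subset_Dp[OF Cc_delta[of x 1]] unfolding Cc_closure_def
    by (auto intro!: bexI[of _ ?d])
  moreover have "bounded (range ?d)" unfolding bounded_iff by (intro exI[of _ 1]) auto
  ultimately show ?thesis by (simp add: B_Cc_closure_def)
qed

lemma B_Cc_closure_subset_BDp: "B_Cc_closure adj p z \<subseteq> B"
  by (auto simp: B_Cc_closure_def Cc_closure_def BDp_def)

text \<open>Evaluation at \<open>x\<close> is \<open>1\<close> at the indicator function of
  \<open>x\<close>, which lies in the closure; so vanishing on the closure already excludes
  evaluations.\<close>

lemma harmonic_boundary_iff:
  "\<xi> \<in> harmonic_boundary adj p z \<longleftrightarrow> \<xi> \<in> Sp adj p \<and> (\<forall>f\<in>B_Cc_closure adj p z. \<xi> f = 0)"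
proof -
  have "\<xi> \<noteq> evaluation adj p x" if "\<forall>f\<in>B_Cc_closure adj p z. \<xi> f = 0" for x
  proof
    assume "\<xi> = evaluation adj p x"
    moreover have "evaluation adj p x (\<lambda>y. if y = x then 1 else 0) = 1"
      using B_Cc_closure_delta[of x] B_Cc_closure_subset_BDp by (auto simp: evaluation_def)
    ultimately show False using that B_Cc_closure_delta[of x z] by auto
  qed
  then show ?thesis by (auto simp: harmonic_boundary_def royden_boundary_def)
qed

lemma harmonic_boundary_of_massive:
  assumes "Dp_massive adj p U"
  obtains \<xi> w where "\<xi> \<in> harmonic_boundary adj p v0" "w \<in> B" "\<And>x. x \<notin> U \<Longrightarrow> w x = 0" "\<xi> w = 1"
proof -
  from massive_function[OF assms] obtain w z where w: "w \<in> B" "\<And>x. 0 \<le> w x" "\<And>x. w x \<le> 1"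
    "\<And>x. x \<notin> U \<Longrightarrow> w x = 0" "z \<notin> U" "\<And>x. x \<in> U \<Longrightarrow> Lap w x = 0" "\<And>s. s < 1 \<Longrightarrow> \<exists>x. s < w x"
    by metis
  have wD: "w \<in> Dp adj p" using w(1) by (simp add: BDp_iff)
  let ?w1 = "\<lambda>x. w x - 1"
  have w1: "?w1 \<in> B" by (intro BDp_diff w BDp_const)
  \<comment> \<open>Annihilating \<open>w - 1\<close> as well forces the value \<open>1\<close> at
    \<open>w\<close>.\<close>
  define N where "N = insert ?w1 (B_Cc_closure adj p v0)"
  have "\<exists>\<xi>\<in>Sp adj p. \<forall>g\<in>N. \<xi> g = 0"
  proof (rule Sp_exists_vanishing)
    show "N \<subseteq> B" using w1 B_Cc_closure_subset_BDp by (auto simp: N_def)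
    fix T and \<epsilon> :: real assume T: "finite T" "T \<subseteq> N" and \<epsilon>: "0 < \<epsilon>"
    have "finite (T - {?w1})" "T - {?w1} \<subseteq> Cc_closure adj p v0"
      using T by (auto simp: N_def B_Cc_closure_def)
    from harmonic_near_sup_and_null[OF wD w(2-7) this \<epsilon>]
    obtain x where x: "1 - \<epsilon> < w x" "\<And>g. g \<in> T - {?w1} \<Longrightarrow> \<bar>g x\<bar> < \<epsilon>" by blast
    have "\<bar>?w1 x\<bar> < \<epsilon>" using x(1) w(3)[of x] by auto
    with x(2) show "\<exists>x. \<forall>g\<in>T. \<bar>g x\<bar> < \<epsilon>" by blast
  qed
  then obtain \<xi> where \<xi>: "\<xi> \<in> Sp adj p" "\<And>g. g \<in> N \<Longrightarrow> \<xi> g = 0" by blast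
  have "\<xi> ?w1 = 0" using \<xi>(2) by (simp add: N_def)
  then have "\<xi> w = 1" using Sp_diff[OF \<xi>(1) w(1) BDp_const[of 1]] Sp_one[OF \<xi>(1)] by simp
  moreover have "\<xi> \<in> harmonic_boundary adj p v0"
    using \<xi> by (simp add: harmonic_boundary_iff N_def)
  ultimately show ?thesis using w(1,4) by (intro that[of \<xi> w]) auto
qed

lemma lepoll_harmonic_boundary_of_massive:
  assumes D: "\<And>i. i \<in> I \<Longrightarrow> Dp_massive adj p (D i)" and disj: "disjoint_family_on D I"
  shows "I \<lesssim> harmonic_boundary adj p v0"
proof -
  have "\<exists>\<xi> w. \<xi> \<in> harmonic_boundary adj p v0 \<and> w \<in> B \<and> (\<forall>x. x \<notin> D i \<longrightarrow> w x = 0) \<and> \<xi> w = 1"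
    if i: "i \<in> I" for i
    using harmonic_boundary_of_massive[OF D[OF i], of v0] by metis
  then obtain \<xi> w where \<xi>: "\<And>i. i \<in> I \<Longrightarrow> \<xi> i \<in> harmonic_boundary adj p v0"
    and w: "\<And>i. i \<in> I \<Longrightarrow> w i \<in> B" "\<And>i x. i \<in> I \<Longrightarrow> x \<notin> D i \<Longrightarrow> w i x = 0"
    and one: "\<And>i. i \<in> I \<Longrightarrow> \<xi> i (w i) = 1" by metis
  have "inj_on \<xi> I"
  proof (rule inj_onI, rule ccontr)
    fix i j assume ij: "i \<in> I" "j \<in> I" "\<xi> i = \<xi> j" "i \<noteq> j"
    have S: "\<xi> i \<in> Sp adj p" using \<xi>[OF ij(1)] by (simp add: harmonic_boundary_iff)
    have "D i \<inter> D j = {}" using disj ij by (auto simp: disjoint_family_on_def)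
    then have "w i x * w j x = 0" for x using w(2)[OF ij(1), of x] w(2)[OF ij(2), of x] by auto
    then have "(\<lambda>x. w i x * w j x) = (\<lambda>_. 0)" by blast
    then have "\<xi> i (\<lambda>x. w i x * w j x) = 0" using Sp_const[OF S, of 0] by simp
    moreover have "\<xi> i (\<lambda>x. w i x * w j x) = 1"
      using Sp_mult[OF S w(1)[OF ij(1)] w(1)[OF ij(2)]] one[OF ij(1)] one[OF ij(2)] ij(3) by simp
    ultimately show False by simp
  qed
  with \<xi> show ?thesis unfolding lepoll_def by blast
qed

section \<open>Harmonic replacement\<close>

text \<open>Edgewise convexity, summed. It makes near-minimisers close in energy; the constant
  depends on \<open>\<epsilon>\<close> but not on the functions, as a Cauchy argument
  requires.\<close>

lemma energy_uniformly_convex: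
  assumes "0 < \<epsilon>"
  obtains C where "0 \<le> C" "\<And>f g. f \<in> Dp adj p \<Longrightarrow> g \<in> Dp adj p \<Longrightarrow>
    E (\<lambda>x. f x - g x) \<le> \<epsilon> * (E f + E g) + C * ((E f + E g) / 2 - E (\<lambda>x. (f x + g x) / 2))"
proof -
  obtain C where C: "0 \<le> C" "\<And>a b. \<bar>a - b\<bar> powr p \<le> \<epsilon> * (\<bar>a\<bar> powr p + \<bar>b\<bar> powr p)
      + C * ((\<bar>a\<bar> powr p + \<bar>b\<bar> powr p) / 2 - \<bar>(a + b) / 2\<bar> powr p)"
    using abs_powr_uniformly_convex[OF p assms] by blast
  have "E (\<lambda>x. f x - g x) \<le> \<epsilon> * (E f + E g) + C * ((E f + E g) / 2 - E (\<lambda>x. (f x + g x) / 2))"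
    if f: "f \<in> Dp adj p" and g: "g \<in> Dp adj p" for f g
  proof -
    define m where "m = (\<lambda>x. (f x + g x) / 2)"
    have m: "m \<in> Dp adj p" unfolding m_def using Dp_cmult[OF Dp_add[OF f g], of "1 / 2"] by simp
    \<comment> \<open>Regroups the right side as a combination of three local energies, each of
      which is summable.\<close>
    define c where "c = \<epsilon> + C / 2"
    have split: "\<epsilon> * (X + Y) + C * ((X + Y) / 2 - M) = c * (X + Y) + (- C) * M" for X Y M
      by (simp add: c_def field_simps)
    have le: "L (\<lambda>x. f x - g x) x \<le> c * (L f x + L g x) + (- C) * L m x" for x
      unfolding local_energy_def sum_distrib_left sum.distrib[symmetric]
    proof (rule sum_mono)
      fix y
      define a b where "a = f y - f x" and "b = g y - g x"
      have eq: "f y - g y - (f x - g x) = a - b" "m y - m x = (a + b) / 2"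
        by (auto simp: a_def b_def m_def field_simps)
      show "\<bar>f y - g y - (f x - g x)\<bar> powr p \<le>
          c * (\<bar>f y - f x\<bar> powr p + \<bar>g y - g x\<bar> powr p) + (- C) * \<bar>m y - m x\<bar> powr p"
        using C(2)[of a b] unfolding split eq a_def[symmetric] b_def[symmetric] .
    qed
    have s: "L f summable_on UNIV" "L g summable_on UNIV" "L m summable_on UNIV"
      using f g m by (auto simp: Dp_iff)
    have s2: "(\<lambda>x. c * (L f x + L g x)) summable_on UNIV" "(\<lambda>x. (- C) * L m x) summable_on UNIV"
      using s by (intro summable_on_cmult_right summable_on_add; simp)+
    have "E (\<lambda>x. f x - g x) \<le> (\<Sum>\<^sub>\<infinity>x. c * (L f x + L g x) + (- C) * L m x)"
      by (rule Dp_dominated(2)[OF le]) (intro summable_on_add s2)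
    also have "\<dots> = c * (E f + E g) + (- C) * E m"
      unfolding infsum_add[OF s2] energy_def infsum_cmult_right' infsum_add[OF s(1,2)] ..
    finally show ?thesis unfolding split m_def .
  qed
  with C(1) show ?thesis using that by blast
qed

text \<open>Every finite partial sum of local energies converges and inherits the bound
  \<open>e\<close>.\<close>

lemma energy_fatou:
  assumes F: "\<And>k. F k \<in> Dp adj p" and lim: "\<And>x. (\<lambda>k. F k x) \<longlonglongrightarrow> f x"
    and le: "\<forall>\<^sub>F k in sequentially. E (F k) \<le> e"
  shows "f \<in> Dp adj p" "E f \<le> e"
proof -
  have sums: "sum (L f) S \<le> e" if "finite S" for S
  proof (rule tendsto_upperbound)
    show "(\<lambda>k. \<Sum>x\<in>S. L (F k) x) \<longlonglongrightarrow> sum (L f) S"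
      by (intro tendsto_sum local_energy_tendsto lim)
    show "\<forall>\<^sub>F k in sequentially. (\<Sum>x\<in>S. L (F k) x) \<le> e"
      using le
    proof eventually_elim
      case (elim k)
      have "(\<Sum>x\<in>S. L (F k) x) \<le> E (F k)" unfolding energy_def
        using F[of k] that local_energy_nonneg by (intro finite_sum_le_infsum) (auto simp: Dp_iff)
      with elim show ?case by simp
    qed
  qed simp
  show f: "f \<in> Dp adj p" unfolding Dp_iff
    by (rule nonneg_bdd_above_summable_on) (use sums local_energy_nonneg in \<open>auto intro!: bdd_aboveI2\<close>)
  show "E f \<le> e" unfolding energy_def
    by (rule infsum_le_finite_sums) (use f sums in \<open>auto simp: Dp_iff\<close>)
qed

text \<open>The first variation is applied at the perturbed function, in the direction that removes
  the perturbation. Minimality then gives \<open>t * q t \<le> 0\<close>, where \<open>q t\<close>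
  is the perturbed Laplacian at \<open>x\<close>, and continuity of \<open>q\<close> leaves only
  \<open>q 0 = 0\<close>.\<close>

lemma harmonic_of_minimal:
  assumes h: "h \<in> Dp adj p" and min: "\<And>t. E h \<le> E (\<lambda>y. h y + (if y = x then t else 0))"
  shows "Lap h x = 0"
proof -
  define q where "q = (\<lambda>t. Lap (\<lambda>y. h y + (if y = x then t else 0)) x)"
  have sgn: "t * q t \<le> 0" for t
  proof -
    define w where "w = (\<lambda>y. h y + (if y = x then t else 0))"
    define \<phi> where "\<phi> = (\<lambda>y. if y = x then - t else 0)"
    have \<phi>: "\<phi> \<in> Cc" unfolding \<phi>_def by (rule Cc_delta)
    have w: "w \<in> Dp adj p" unfolding w_def by (intro Dp_add h Cc_subset_Dp Cc_delta)
    have "(\<lambda>y. w y + \<phi> y) = h" by (auto simp: w_def \<phi>_def)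
    moreover have "(\<Sum>y | \<phi> y \<noteq> 0. \<phi> y * Lap w y) = (\<Sum>y\<in>{x}. \<phi> y * Lap w y)"
      by (intro sum.mono_neutral_left) (auto simp: \<phi>_def)
    ultimately have "E w + 2 * p * (t * q t) \<le> E h"
      using energy_first_variation[OF w \<phi>] by (simp add: \<phi>_def q_def w_def)
    with min[of t] have "2 * p * (t * q t) \<le> 0" by (simp add: w_def)
    then show ?thesis using p by (simp add: mult_le_0_iff)
  qed
  have cont: "isCont q 0" unfolding q_def p_laplacian_def
  proof (intro continuous_sum)
    fix y
    \<comment> \<open>Each difference is affine in \<open>t\<close>, with slope \<open>0\<close> for
      \<open>y = x\<close> and \<open>-1\<close> otherwise.\<close>
    define c where "c = (if y = x then 1 else 0) - (1::real)"
    have eq: "h y + (if y = x then t else 0) - (h x + (if x = x then t else 0)) = h y - h x + t * c" for t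
      by (simp add: c_def)
    show "isCont (\<lambda>t. \<bar>h y + (if y = x then t else 0) - (h x + (if x = x then t else 0))\<bar> powr (p - 2) *
        (h y + (if y = x then t else 0) - (h x + (if x = x then t else 0)))) 0"
      unfolding eq by (rule isCont_o2[OF _ isCont_abs_powr_mult[OF p]]) (intro continuous_intros)
  qed
  \<comment> \<open>Taking \<open>s = 1\<close> and \<open>s = - 1\<close> approaches
    \<open>0\<close> from both sides.\<close>
  have lim: "(\<lambda>n. q (s * inverse (real (Suc n)))) \<longlonglongrightarrow> q 0" for s
  proof (rule isCont_tendsto_compose[OF cont])
    show "(\<lambda>n. s * inverse (real (Suc n))) \<longlonglongrightarrow> 0"
      using tendsto_mult_left[OF LIMSEQ_inverse_real_of_nat, of s] by simp
  qed
  have "q (1 * inverse (real (Suc n))) \<le> 0" "0 \<le> q (- 1 * inverse (real (Suc n)))" for n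
    using sgn[of "1 * inverse (real (Suc n))"] sgn[of "- 1 * inverse (real (Suc n))"]
    by (auto simp: mult_le_0_iff zero_le_mult_iff)
  then have "q 0 \<le> 0" "0 \<le> q 0"
    using LIMSEQ_le_const2[OF lim[of 1]] LIMSEQ_le_const[OF lim[of "- 1"]] by auto
  then show ?thesis by (simp add: q_def)
qed

text \<open>
  A minimising sequence is Cauchy in energy by uniform convexity, and converges pointwise because
  it vanishes at \<open>z\<close> and the graph is connected.
\<close>

lemma harmonic_replacement:
  assumes f: "f \<in> Dp adj p" and f01: "\<And>x. 0 \<le> f x" "\<And>x. f x \<le> 1"
    and f0: "\<And>x. x \<notin> W \<Longrightarrow> f x = 0" and z: "z \<notin> W"
  obtains h where "h \<in> Dp adj p" "\<And>x. 0 \<le> h x" "\<And>x. h x \<le> 1" "\<And>x. x \<notin> W \<Longrightarrow> h x = 0"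
    "\<And>x. x \<in> W \<Longrightarrow> Lap h x = 0" "(\<lambda>x. h x - f x) \<in> Cc_closure adj p z"
proof -
  \<comment> \<open>Allowing only finitely many changes of \<open>f\<close> places the limit minus
    \<open>f\<close> in the closure of the finitely supported functions. The bounds and the
    vanishing off \<open>W\<close> pass to pointwise limits.\<close>
  define A where "A = {g \<in> Dp adj p. (\<forall>x. 0 \<le> g x \<and> g x \<le> 1) \<and> finite {x. g x \<noteq> f x} \<and> (\<forall>x. x \<notin> W \<longrightarrow> g x = 0)}"
  have fA: "f \<in> A" using f f01 f0 by (auto simp: A_def)
  define c where "c = Inf (E ` A)"
  have bdd: "bdd_below (E ` A)" by (rule bdd_belowI2[of _ 0]) (rule energy_nonneg)
  have c_le: "c \<le> E g" if "g \<in> A" for g unfolding c_def using that bdd by (intro cInf_lower) auto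
  have c0: "0 \<le> c" unfolding c_def using fA energy_nonneg by (intro cInf_greatest) auto
  have "\<exists>g\<in>A. E g < c + inverse (real (Suc k))" for k
  proof -
    have "Inf (E ` A) < c + inverse (real (Suc k))" by (simp add: c_def)
    from cInf_lessD[OF _ this] fA show ?thesis by auto
  qed
  then obtain h where hA: "\<And>k. h k \<in> A" and h_lt: "\<And>k. E (h k) < c + inverse (real (Suc k))" by metis
  have hD: "h k \<in> Dp adj p" for k using hA[of k] by (simp add: A_def)
  have mid: "(\<lambda>x. (a x + b x) / 2) \<in> A" if "a \<in> A" "b \<in> A" for a b
  proof -
    have "{x. (a x + b x) / 2 \<noteq> f x} \<subseteq> {x. a x \<noteq> f x} \<union> {x. b x \<noteq> f x}" by auto
    then have "finite {x. (a x + b x) / 2 \<noteq> f x}" using that by (auto simp: A_def intro: finite_subset)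
    moreover have "(\<lambda>x. (a x + b x) / 2) \<in> Dp adj p"
      using that Dp_cmult[OF Dp_add, of a b "1 / 2"] by (simp add: A_def)
    moreover have "0 \<le> (a x + b x) / 2 \<and> (a x + b x) / 2 \<le> 1" for x
    proof -
      have "0 \<le> a x" "a x \<le> 1" "0 \<le> b x" "b x \<le> 1" using that by (auto simp: A_def)
      then show ?thesis by simp
    qed
    ultimately show ?thesis using that by (simp add: A_def)
  qed
  have cauchy: "\<exists>K. \<forall>k\<ge>K. \<forall>l\<ge>K. E (\<lambda>x. h k x - h l x) \<le> e" if e: "0 < e" for e
  proof -
    \<comment> \<open>With energies at most \<open>c + 1\<close>, the first term of the convexity
      estimate is at most \<open>e / 2\<close>; the choice of \<open>K\<close> below does the same
      for the second.\<close>
    define \<epsilon> where "\<epsilon> = e / (4 * (c + 1))"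
    have \<epsilon>: "0 < \<epsilon>" using e c0 by (simp add: \<epsilon>_def)
    obtain C where C: "0 \<le> C" "\<And>f g. f \<in> Dp adj p \<Longrightarrow> g \<in> Dp adj p \<Longrightarrow>
      E (\<lambda>x. f x - g x) \<le> \<epsilon> * (E f + E g) + C * ((E f + E g) / 2 - E (\<lambda>x. (f x + g x) / 2))"
      using energy_uniformly_convex[OF \<epsilon>] by blast
    obtain K where K: "inverse (real (Suc K)) < e / (2 * (C + 1))"
      using reals_Archimedean[of "e / (2 * (C + 1))"] e C by auto
    have "E (\<lambda>x. h k x - h l x) \<le> e" if "k \<ge> K" "l \<ge> K" for k l
    proof -
      define r where "r = inverse (real (Suc K))"
      have "inverse (real (Suc k)) \<le> r" "inverse (real (Suc l)) \<le> r"
        using that by (auto simp: r_def)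
      then have kl: "E (h k) \<le> c + r" "E (h l) \<le> c + r" using h_lt[of k] h_lt[of l] by auto
      have r: "0 < r" "r \<le> 1" by (auto simp: r_def inverse_le_1_iff)
      \<comment> \<open>The midpoint is again a competitor, so its energy is at least
        \<open>c\<close>.\<close>
      have defect: "(E (h k) + E (h l)) / 2 - E (\<lambda>x. (h k x + h l x) / 2) \<le> r"
      proof -
        have "(X + Y) / 2 - M \<le> r" if "X \<le> c + r" "Y \<le> c + r" "c \<le> M" for X Y M
          using that by (simp add: field_simps)
        then show ?thesis using kl c_le[OF mid[OF hA hA, of k l]] .
      qed
      have "E (\<lambda>x. h k x - h l x) \<le> \<epsilon> * (E (h k) + E (h l)) + C * ((E (h k) + E (h l)) / 2 - E (\<lambda>x. (h k x + h l x) / 2))"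
        by (rule C(2)[OF hD hD])
      also have "\<dots> \<le> \<epsilon> * (2 * (c + 1)) + C * r"
        using kl r defect \<epsilon> C(1) by (intro add_mono mult_left_mono) auto
      also have "\<epsilon> * (2 * (c + 1)) = e / 2" using c0 by (simp add: \<epsilon>_def field_simps)
      also have "C * r \<le> (C + 1) * (e / (2 * (C + 1)))"
        using K C(1) r by (intro mult_mono) (auto simp: r_def)
      also have "\<dots> = e / 2" using C(1) by (simp add: field_simps)
      finally show ?thesis by simp
    qed
    then show ?thesis by blast
  qed
  have "convergent (\<lambda>k. h k x)" for x
  proof (rule connected_induct[where P = "\<lambda>x. convergent (\<lambda>k. h k x)"])
    have "h k z = 0" for k using hA[of k] z by (simp add: A_def)
    then show "convergent (\<lambda>k. h k z)" by (simp add: convergent_const)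
  next
    fix x y assume x: "convergent (\<lambda>k. h k x)" and xy: "adj x y"
    have "Cauchy (\<lambda>k. h k y - h k x)"
    proof (rule CauchyI)
      fix e :: real assume e: "0 < e"
      obtain K where K: "\<And>k l. k \<ge> K \<Longrightarrow> l \<ge> K \<Longrightarrow> E (\<lambda>x. h k x - h l x) \<le> (e / 2) powr p"
        using cauchy[of "(e / 2) powr p"] e by auto
      have "norm (h k y - h k x - (h l y - h l x)) < e" if "k \<ge> K" "l \<ge> K" for k l
      proof -
        have "\<bar>(h k y - h l y) - (h k x - h l x)\<bar> powr p \<le> (e / 2) powr p"
          using edge_le_energy[OF Dp_diff[OF hD hD, of k l] xy] K[OF that] by linarith
        then have "\<bar>(h k y - h l y) - (h k x - h l x)\<bar> \<le> e / 2"
          using powr_less_mono2[of p "e / 2" "\<bar>(h k y - h l y) - (h k x - h l x)\<bar>"] p e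
          by (cases "e / 2 < \<bar>(h k y - h l y) - (h k x - h l x)\<bar>") auto
        moreover have "h k y - h k x - (h l y - h l x) = (h k y - h l y) - (h k x - h l x)" by simp
        ultimately show ?thesis using e unfolding real_norm_def by linarith
      qed
      then show "\<exists>M. \<forall>m\<ge>M. \<forall>n\<ge>M. norm (h m y - h m x - (h n y - h n x)) < e" by blast
    qed
    from convergent_add[OF Cauchy_convergent[OF this] x] show "convergent (\<lambda>k. h k y)" by simp
  qed
  then have "\<forall>x. \<exists>l. (\<lambda>k. h k x) \<longlonglongrightarrow> l" by (simp add: convergent_def)
  then obtain g where g: "\<And>x. (\<lambda>k. h k x) \<longlonglongrightarrow> g x" by metis
  \<comment> \<open>Fatou's lemma lets the second index of the Cauchy estimate tend to
    infinity.\<close>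
  have small: "\<exists>K. \<forall>k\<ge>K. (\<lambda>x. h k x - g x) \<in> Dp adj p \<and> E (\<lambda>x. h k x - g x) \<le> e" if "0 < e" for e
  proof -
    from cauchy[OF that] obtain K where K: "\<And>k l. k \<ge> K \<Longrightarrow> l \<ge> K \<Longrightarrow> E (\<lambda>x. h k x - h l x) \<le> e" by blast
    have "(\<lambda>x. h k x - g x) \<in> Dp adj p \<and> E (\<lambda>x. h k x - g x) \<le> e" if k: "k \<ge> K" for k
    proof
      have ev: "\<forall>\<^sub>F l in sequentially. E (\<lambda>x. h k x - h l x) \<le> e"
        using K[OF k] by (auto simp: eventually_sequentially)
      note fatou = energy_fatou[of "\<lambda>l x. h k x - h l x", OF Dp_diff[OF hD hD] tendsto_diff[OF tendsto_const g] ev]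
      show "(\<lambda>x. h k x - g x) \<in> Dp adj p" by (rule fatou(1))
      show "E (\<lambda>x. h k x - g x) \<le> e" by (rule fatou(2))
    qed
    then show ?thesis by blast
  qed
  have gD: "g \<in> Dp adj p"
  proof -
    from small[of 1] obtain k where "(\<lambda>x. h k x - g x) \<in> Dp adj p" by auto
    from Dp_diff[OF hD[of k] this] show ?thesis by simp
  qed
  have lim: "(\<lambda>k. E (\<lambda>x. h k x - g x)) \<longlonglongrightarrow> 0"
  proof (rule LIMSEQ_I)
    fix r :: real assume "0 < r"
    with small[of "r / 2"] obtain K where "\<And>k. k \<ge> K \<Longrightarrow> E (\<lambda>x. h k x - g x) \<le> r / 2" by auto
    with \<open>0 < r\<close> energy_nonneg
    show "\<exists>no. \<forall>n\<ge>no. norm (E (\<lambda>x. h n x - g x) - 0) < r" by (intro exI[of _ K]) fastforce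
  qed
  have g01: "0 \<le> g x" "g x \<le> 1" for x
  proof -
    have "0 \<le> h k x \<and> h k x \<le> 1" for k using hA[of k] by (simp add: A_def)
    then show "0 \<le> g x" "g x \<le> 1" using LIMSEQ_le_const[OF g] LIMSEQ_le_const2[OF g] by auto
  qed
  have g0: "g x = 0" if "x \<notin> W" for x
  proof -
    have "h k x = 0" for k using hA[of k] that by (simp add: A_def)
    then show ?thesis using g[of x] by (simp add: LIMSEQ_const_iff)
  qed
  have Eg: "E g \<le> c"
  proof (rule energy_limit_le[OF hD gD lim])
    have "(\<lambda>k. c + inverse (real (Suc k))) \<longlonglongrightarrow> c + 0"
      by (intro tendsto_intros LIMSEQ_inverse_real_of_nat)
    then have up: "(\<lambda>k. c + inverse (real (Suc k))) \<longlonglongrightarrow> c" by simp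
    show "(\<lambda>k. E (h k)) \<longlonglongrightarrow> c"
      by (rule tendsto_sandwich[OF _ _ tendsto_const up])
         (intro always_eventually allI c_le hA less_imp_le[OF h_lt])+
  qed
  have harm: "Lap g x = 0" if x: "x \<in> W" for x
  proof (rule harmonic_of_minimal[OF gD])
    fix t :: real
    let ?d = "\<lambda>y. if y = x then t else 0"
    have d: "?d \<in> Dp adj p" by (intro Cc_subset_Dp Cc_delta)
    have "c \<le> E (\<lambda>y. g y + ?d y)"
    proof (rule energy_limit_ge[where F = "\<lambda>k y. h k y + ?d y"])
      show hd: "(\<lambda>y. h k y + ?d y) \<in> Dp adj p" for k by (intro Dp_add hD d)
      show "(\<lambda>y. g y + ?d y) \<in> Dp adj p" by (intro Dp_add gD d)
      show "(\<lambda>k. E (\<lambda>y. h k y + ?d y - (g y + ?d y))) \<longlonglongrightarrow> 0" using lim by simp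
      fix k
      \<comment> \<open>Changing \<open>h k\<close> at \<open>x\<close> may leave the interval
        [0, 1]; clamping restores a competitor without raising the energy.\<close>
      define r where "r = (\<lambda>y. max 0 (min 1 (h k y + ?d y)))"
      have rl: "\<bar>r a - r b\<bar> \<le> 1 * \<bar>h k a + ?d a - (h k b + ?d b)\<bar>" for a b
        unfolding r_def by (simp add: max_def min_def)
      have r: "r \<in> Dp adj p" "E r \<le> 1 powr p * E (\<lambda>y. h k y + ?d y)"
        using Dp_lipschitz[OF hd[of k], of 1 r] rl by auto
      have hk: "0 \<le> h k y" "h k y \<le> 1" "y \<notin> W \<Longrightarrow> h k y = 0" "finite {x. h k x \<noteq> f x}" for y
        using hA[of k] by (auto simp: A_def)
      have "r y = h k y" if "y \<noteq> x" for y using that hk(1,2)[of y] by (simp add: r_def)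
      then have "{y. r y \<noteq> f y} \<subseteq> insert x {y. h k y \<noteq> f y}" by auto
      then have "finite {y. r y \<noteq> f y}" by (rule finite_subset) (use hk(4) in simp)
      moreover have "r y = 0" if "y \<notin> W" for y using that x hk(3)[OF that] by (auto simp: r_def)
      ultimately have "r \<in> A" using r(1) by (simp add: A_def) (simp add: r_def)
      from c_le[OF this] r(2) show "c \<le> E (\<lambda>y. h k y + ?d y)" by simp
    qed
    with Eg show "E g \<le> E (\<lambda>y. g y + ?d y)" by simp
  qed
  have "(\<lambda>x. g x - f x) \<in> Cc_closure adj p z" unfolding Cc_closure_def
  proof (intro CollectI conjI allI impI)
    show "(\<lambda>x. g x - f x) \<in> Dp adj p" by (intro Dp_diff gD f)
    fix \<epsilon> :: real assume \<epsilon>: "0 < \<epsilon>"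
    obtain k where k: "E (\<lambda>x. h k x - g x) \<le> (\<epsilon> / 2) powr p" using small[of "(\<epsilon> / 2) powr p"] \<epsilon> by auto
    have hz: "h k z = 0" using hA[of k] z by (simp add: A_def)
    show "\<exists>q\<in>Cc. Dp_norm adj p z (\<lambda>x. g x - f x - q x) < \<epsilon>"
    \<comment> \<open>The finitely supported approximants are \<open>h k - f\<close>. The base
      vertex contributes nothing to the norm, because \<open>g\<close> and \<open>h k\<close> vanish
      at \<open>z\<close>.\<close>
    proof (rule bexI[of _ "\<lambda>x. h k x - f x"])
      show "(\<lambda>x. h k x - f x) \<in> Cc" using hA[of k] by (simp add: Cc_def A_def)
      have "Dp_norm adj p z (\<lambda>x. g x - f x - (h k x - f x)) = E (\<lambda>x. h k x - g x) powr (1 / p)"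
        using p hz g0[OF z] by (simp add: Dp_norm_def energy_diff_commute[of g])
      also have "\<dots> \<le> ((\<epsilon> / 2) powr p) powr (1 / p)"
        using k p energy_nonneg by (intro powr_mono2) auto
      also have "\<dots> = \<epsilon> / 2" using p \<epsilon> by (simp add: powr_powr)
      finally show "Dp_norm adj p z (\<lambda>x. g x - f x - (h k x - f x)) < \<epsilon>" using \<epsilon> by simp
    qed
  qed
  with gD g01 g0 harm show ?thesis by (intro that[of g]) auto
qed

section \<open>From characters to massive sets\<close>

lemma p_laplacian_cmult: "Lap (\<lambda>x. c * f x) x = \<bar>c\<bar> powr (p - 2) * c * Lap f x"
  unfolding p_laplacian_def sum_distrib_left
  by (intro sum.cong) (simp_all add: right_diff_distrib[symmetric] abs_mult powr_mult)

text \<open>Take for \<open>U\<close> the component of \<open>x0\<close> in \<open>W\<close>. Its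
  outer boundary lies outside \<open>W\<close>, where \<open>h\<close> vanishes, and is nonempty
  because \<open>z\<close> is not in \<open>U\<close>. The maximum principle excludes a finite
  component.\<close>

lemma massive_of_harmonic:
  assumes h: "h \<in> Dp adj p" and h01: "\<And>x. 0 \<le> h x" "\<And>x. h x \<le> 1"
    and h0: "\<And>x. x \<notin> W \<Longrightarrow> h x = 0" and z: "z \<notin> W"
    and harm: "\<And>x. x \<in> W \<Longrightarrow> Lap h x = 0" and x0: "0 < h x0"
  obtains U where "U \<subseteq> W" "Dp_massive adj p U"
proof -
  define R where "R = (\<lambda>a b. a \<in> W \<and> b \<in> W \<and> adj a b)"
  define U where "U = {y. R\<^sup>*\<^sup>* x0 y}"
  have x0W: "x0 \<in> W" using h0[of x0] x0 by auto
  have x0U: "x0 \<in> U" by (simp add: U_def)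
  have UW: "U \<subseteq> W"
  proof
    fix y assume "y \<in> U"
    then have "R\<^sup>*\<^sup>* x0 y" by (simp add: U_def)
    then show "y \<in> W" by (induction) (auto simp: R_def x0W)
  qed
  have ext: "y \<in> U" if "x \<in> U" "adj x y" "y \<in> W" for x y
  proof -
    have "R x y" using that UW by (auto simp: R_def)
    with that(1) show ?thesis unfolding U_def by (simp add: rtranclp.rtrancl_into_rtrancl)
  qed
  have bdW: "y \<notin> W" if "y \<in> outer_boundary adj U" for y
    using that ext adj_sym by (auto simp: outer_boundary_def)
  have conn: "connected_subset adj U"
  proof -
    define Q where "Q = (\<lambda>a b. a \<in> U \<and> b \<in> U \<and> adj a b)"
    have to: "Q\<^sup>*\<^sup>* x0 y" if "R\<^sup>*\<^sup>* x0 y" for y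
      using that
    proof (induction)
      case (step y y')
      have "y \<in> U" "y' \<in> U" using step(1,2) by (auto simp: U_def)
      then have "Q y y'" using step(2) by (simp add: Q_def R_def)
      with step(3) show ?case by simp
    qed simp
    have "symp Q" using adj_sym by (auto simp: Q_def symp_def)
    then have "symp Q\<^sup>*\<^sup>*" by (rule symp_rtranclp)
    then have "Q\<^sup>*\<^sup>* y y'" if "y \<in> U" "y' \<in> U" for y y'
      using to[of y] to[of y'] that by (auto simp: U_def dest: sympD intro: rtranclp_trans)
    then show ?thesis by (simp add: connected_subset_def Q_def)
  qed
  have bd: "outer_boundary adj U \<noteq> {}"
  proof
    assume empty: "outer_boundary adj U = {}"
    have "z \<in> U"
    proof (rule connected_induct[where P = "\<lambda>x. x \<in> U", OF x0U], rule ccontr)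
      fix x y assume "x \<in> U" "adj x y" "y \<notin> U"
      then have "x \<in> nbrs adj y \<inter> U" using adj_sym by simp
      moreover have "nbrs adj y \<inter> U = {}" using \<open>y \<notin> U\<close> empty by (auto simp: outer_boundary_def)
      ultimately show False by blast
    qed
    with UW z show False by auto
  qed
  have inf: "infinite U"
  proof
    assume fin: "finite U"
    define w where "w = (\<lambda>x. if x \<in> U then h x else 0)"
    have wh: "w y = h y" if "x \<in> U" "adj x y" for x y
      using that ext[OF that] h0[of y] by (auto simp: w_def)
    \<comment> \<open>If \<open>U\<close> is finite, \<open>w\<close> is its own finitely supported
      approximant, and the maximum principle at level \<open>0\<close> contradicts
      \<open>0 < h x0\<close>.\<close>
    have wCc: "w \<in> Cc" using fin unfolding Cc_def w_def by (auto elim: finite_subset[rotated])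
    have "w x0 \<le> 0"
    proof (rule harmonic_le_of_approx[where \<phi> = "\<lambda>_. w" and D = U and z = z])
      show "w \<in> Dp adj p" by (rule Cc_subset_Dp[OF wCc])
      show "w z \<le> 0" using z UW by (auto simp: w_def)
      show "Lap w x = 0" if "x \<in> U" for x
      proof -
        have "Lap w x = Lap h x" unfolding p_laplacian_def
          using wh[OF that] that by (intro sum.cong) (auto simp: w_def)
        then show ?thesis using harm that UW by auto
      qed
      have "(\<lambda>x. w x - max 0 (w x - 0)) = (\<lambda>_. 0)" using h01(1) by (auto simp: w_def)
      then show "(\<lambda>_. E (\<lambda>x. w x - max 0 (w x - 0))) \<longlonglongrightarrow> 0"
        by (simp add: energy_def local_energy_eq_0)
    qed (use wCc in \<open>auto simp: w_def\<close>)
    then show False using x0 x0U by (simp add: w_def)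
  qed
  define s where "s = (SUP x\<in>U. h x)"
  have bdd: "bdd_above (h ` U)" using h01 by (intro bdd_aboveI2[of _ _ 1])
  have le_s: "h x \<le> s" if "x \<in> U" for x unfolding s_def using that bdd by (rule cSUP_upper)
  have s: "0 < s" using le_s[OF x0U] x0 by simp
  \<comment> \<open>Division by the supremum over \<open>U\<close> normalises; homogeneity of the
    Laplacian keeps \<open>u\<close> harmonic on \<open>U\<close>.\<close>
  define u where "u = (\<lambda>x. 1 / s * h x)"
  have u_le: "u x \<le> 1" if "x \<in> U" for x using le_s[OF that] s by (simp add: u_def)
  have "(SUP x\<in>U. u x) = 1"
  proof (rule antisym)
    show "(SUP x\<in>U. u x) \<le> 1" using x0U u_le by (intro cSUP_least) auto
    have "h x \<le> s * (SUP x\<in>U. u x)" if "x \<in> U" for x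
    proof -
      have "u x \<le> (SUP x\<in>U. u x)" using u_le by (intro cSUP_upper that bdd_aboveI2[of _ _ 1])
      then have "s * u x \<le> s * (SUP x\<in>U. u x)" using s by (intro mult_left_mono) auto
      then show ?thesis using s by (simp add: u_def)
    qed
    then have "s \<le> s * (SUP x\<in>U. u x)" unfolding s_def using x0U by (intro cSUP_least) auto
    then show "1 \<le> (SUP x\<in>U. u x)" using s by simp
  qed
  moreover have "u \<in> B" unfolding u_def using h h01 by (intro BDp_cmult) (auto simp: BDp_iff intro!: exI[of _ 1])
  moreover have "\<forall>x. 0 \<le> u x" using h01(1) s by (simp add: u_def)
  moreover have "\<forall>x\<in>U. Lap u x = 0" using UW harm unfolding u_def p_laplacian_cmult by auto
  moreover have "\<forall>x\<in>outer_boundary adj U. u x = 0" using bdW h0 by (simp add: u_def)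
  ultimately have "Dp_massive adj p U" unfolding Dp_massive_def using inf conn bd by blast
  with UW show ?thesis by (rule that)
qed

lemma massive_of_lepoll_harmonic_boundary:
  fixes n :: nat
  assumes "{1..n} \<lesssim> harmonic_boundary adj p v0"
  shows "\<exists>D. (\<forall>i\<in>{1..n}. Dp_massive adj p (D i)) \<and> disjoint_family_on D {1..n}"
proof -
  from assms obtain \<xi> where inj: "inj_on \<xi> {1..n}" and \<xi>: "\<And>i. i \<in> {1..n} \<Longrightarrow> \<xi> i \<in> harmonic_boundary adj p v0"
    unfolding lepoll_def by (metis image_subset_iff)
  have S: "\<xi> i \<in> Sp adj p" if "i \<in> {1..n}" for i using \<xi>[OF that] by (simp add: harmonic_boundary_iff)
  have "\<xi> ` {1..n} \<subseteq> Sp adj p" using S by blast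
  \<comment> \<open>The prescribed value at each character is its index, recovered through the
    inverse of \<open>\<xi>\<close>.\<close>
  from Sp_interpolate[OF _ this, of "\<lambda>\<psi>. real (inv_into {1..n} \<xi> \<psi>)"]
  obtain G where G: "G \<in> B" and GX: "\<forall>\<psi>\<in>\<xi> ` {1..n}. \<psi> G = complex_of_real (real (inv_into {1..n} \<xi> \<psi>))"
    by blast
  have Gi: "\<xi> i G = complex_of_real (real i)" if "i \<in> {1..n}" for i
    using GX inv_into_f_f[OF inj that] that by auto
  have "\<exists>U. U \<subseteq> {x. \<bar>G x - real i\<bar> < 1 / 2} \<and> Dp_massive adj p U" if i: "i \<in> {1..n}" for i
  proof -
    \<comment> \<open>The support radius \<open>1 / 2\<close> is half the distance of consecutive
      integers, so the sets for different indices are disjoint.\<close>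
    define F where "F = (\<lambda>t. max 0 (1 - 2 * \<bar>t - real i\<bar>))"
    have F: "\<bar>F a - F b\<bar> \<le> 2 * \<bar>a - b\<bar>" for a b by (auto simp: F_def max_def abs_if)
    \<comment> \<open>Subtracting the value at \<open>v0\<close> keeps \<open>W\<close> below away from \<open>v0\<close>, so that its components have a boundary.\<close>
    define d where "d = (\<lambda>y. if y = v0 then 1 else (0::real))"
    define f where "f = (\<lambda>x. F (G x) - F (G v0) * d x)"
    have dB: "d \<in> B" "\<xi> i d = 0"
      using B_Cc_closure_delta[of v0 v0] B_Cc_closure_subset_BDp[of v0] \<xi>[OF i]
      by (auto simp: d_def harmonic_boundary_iff)
    have FG: "(\<lambda>x. F (G x)) \<in> B" by (rule BDp_comp[OF G _ F]) simp
    have fB: "f \<in> B" unfolding f_def by (intro BDp_diff BDp_cmult FG dB)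
    have "\<xi> i (\<lambda>x. F (G x)) = 1" using Sp_comp[OF S[OF i] G _ F] Gi[OF i] by (simp add: F_def)
    then have f1: "\<xi> i f = 1" unfolding f_def
      using Sp_diff[OF S[OF i] FG BDp_cmult[OF dB(1)]] Sp_cmult[OF S[OF i] dB(1)] dB(2) by simp
    define W where "W = {x. \<bar>G x - real i\<bar> < 1 / 2} - {v0}"
    have f01: "0 \<le> f x" "f x \<le> 1" for x by (auto simp: f_def d_def F_def)
    have f0: "f x = 0" if "x \<notin> W" for x
    proof (cases "x = v0")
      case False
      with that have "1 / 2 \<le> \<bar>G x - real i\<bar>" by (simp add: W_def not_less)
      with False show ?thesis by (simp add: f_def d_def F_def)
    qed (simp add: f_def d_def)
    have v0: "v0 \<notin> W" by (simp add: W_def)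
    have fD: "f \<in> Dp adj p" using fB by (simp add: BDp_iff)
    obtain h where h: "h \<in> Dp adj p" "\<And>x. 0 \<le> h x" "\<And>x. h x \<le> 1" "\<And>x. x \<notin> W \<Longrightarrow> h x = 0"
      "\<And>x. x \<in> W \<Longrightarrow> Lap h x = 0" and cl: "(\<lambda>x. h x - f x) \<in> Cc_closure adj p v0"
      using harmonic_replacement[OF fD f01 f0 v0] by metis
    have hB: "h \<in> B" using h(1-3) by (auto simp: BDp_iff intro!: exI[of _ 1])
    \<comment> \<open>The replacement changes \<open>f\<close> only by a function that
      \<open>\<xi> i\<close> annihilates, so the value \<open>1\<close> survives and
      \<open>h\<close> is not zero.\<close>
    have "(\<lambda>x. h x - f x) \<in> B_Cc_closure adj p v0"
      using cl BDp_diff[OF hB fB] by (simp add: B_Cc_closure_def BDp_def)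
    then have "\<xi> i (\<lambda>x. h x - f x) = 0" using \<xi>[OF i] by (simp add: harmonic_boundary_iff)
    then have "\<xi> i h = 1" using Sp_diff[OF S[OF i] hB fB] f1 by simp
    then have "h \<noteq> (\<lambda>_. 0)" using Sp_const[OF S[OF i], of 0] by auto
    then obtain x0 where "h x0 \<noteq> 0" by auto
    with h(2)[of x0] have "0 < h x0" by simp
    from massive_of_harmonic[OF h(1-4) v0 h(5) this]
    obtain U where "U \<subseteq> W" "Dp_massive adj p U" by metis
    then show ?thesis by (intro exI[of _ U]) (auto simp: W_def)
  qed
  then obtain D where D: "\<And>i. i \<in> {1..n} \<Longrightarrow> D i \<subseteq> {x. \<bar>G x - real i\<bar> < 1 / 2}"
    "\<And>i. i \<in> {1..n} \<Longrightarrow> Dp_massive adj p (D i)" by metis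
  have "D i \<inter> D j = {}" if ij: "i \<in> {1..n}" "j \<in> {1..n}" "i \<noteq> j" for i j
  proof (rule ccontr)
    assume "D i \<inter> D j \<noteq> {}"
    then obtain x where "\<bar>G x - real i\<bar> < 1 / 2" "\<bar>G x - real j\<bar> < 1 / 2"
      using D(1)[OF ij(1)] D(1)[OF ij(2)] by auto
    then have "\<bar>real i - real j\<bar> < 1" by linarith
    with ij(3) show False by linarith
  qed
  with D(2) show ?thesis by (intro exI[of _ D]) (auto simp: disjoint_family_on_def)
qed

end

text \<open>Cardinality at least \<open>n\<close> is encoded as an injection from
  \<open>{1..n}\<close>, which gives the intended meaning for an infinite boundary as well.
  \<open>v0\<close> is the base vertex of the norm.\<close>

theorem theorem2p3:
  fixes adj :: "'v \<Rightarrow> 'v \<Rightarrow> bool" and p :: real and v0 :: 'v and n :: nat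
  assumes "1 < p"
    and "symp adj" and "irreflp adj"
    and "connected_subset adj UNIV"
    and "bounded_degree adj"
    and "countable (UNIV :: 'v set)" and "infinite (UNIV :: 'v set)"
  shows "(\<exists>D :: nat \<Rightarrow> 'v set. (\<forall>i\<in>{1..n}. Dp_massive adj p (D i)) \<and> disjoint_family_on D {1..n})
         \<longleftrightarrow> {1..n} \<lesssim> harmonic_boundary adj p v0"
proof -
  interpret p_graph adj p
    using assms by unfold_locales (auto simp: symp_def bounded_degree_def)
  show ?thesis
    using lepoll_harmonic_boundary_of_massive[of "{1..n}"] massive_of_lepoll_harmonic_boundary[of n v0]
    by metis
qed

end
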